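(* Define functions $U(t)$, $V(t)$ by $$U(t)=\frac{{}_2F_1(\tfrac34,\tfrac34;\tfrac32;4t)}{{}_2F_1(\tfrac14,\tfrac14;\tfrac12;4t)},\qquad V(t)=\sqrt{{}_2F_1(\tfrac14,\tfrac14;\tfrac12;4t)} .$$ Then $(d(n))_{n=0}^\infty$ is the unique sequence of real numbers satisfying the generating function identity $$\sum_{n=0}^\infty \frac{d(n)}{2^n(2n)!}\,t^n\,U(t)^{2n}=V(t)\qquad (|t|<1/4).$$
   Context: The Gauss hypergeometric function is ${}_2F_1(a,b;c;z)=\sum_{n=0}^\infty \frac{1}{n!}\frac{(a)_n(b)_n}{(c)_n}z^n$ with $(x)_n=x(x+1)\cdots(x+n-1)$; the square root is the principal branch, so $V(0)=1$. The sequence $(d(n))_{n=0}^\infty$ is defined as follows. Let $\theta_3(x)=\sum_{n=-\infty}^\infty e^{-\pi n^2 x}$ for $\operatorname{Re}(x)>0$, and let $\sigma_3(z)=\frac{1}{\sqrt{1+z}}\,\theta_3\!\left(\frac{1-z}{1+z}\right)$ for $|z|<1$ (principal square root); $\sigma_3$ is an even function. Let $\Phi=\frac{\Gamma(1/4)^8}{128\pi^4}$. The real numbers $d(n)$ are defined by the Taylor expansion $$\sigma_3(z)=\theta_3(1)\sum_{n=0}^\infty\frac{d(n)}{(2n)!}\Phi^n z^{2n}\qquad(|z|<1).$$ *)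

theory Defs
  imports "HOL-Complex_Analysis.Complex_Analysis"
begin

definition hyp2F1 :: "complex \<Rightarrow> complex \<Rightarrow> complex \<Rightarrow> complex \<Rightarrow> complex" where
  "hyp2F1 a b c z =
     (\<Sum>n. 1 / fact n * (pochhammer a n * pochhammer b n / pochhammer c n) * z ^ n)"

lemma hyp2F1_eq_eval_fps: "hyp2F1 a b c z = eval_fps (fps_hypergeo [a, b] [c] 1) z"
  by (simp add: hyp2F1_def eval_fps_def fps_hypergeo_nth mult_ac)

definition theta3 :: "complex \<Rightarrow> complex" where
  "theta3 x = (\<Sum>\<^sub>\<infinity>n\<in>(UNIV :: int set). exp (- of_real pi * of_int n ^ 2 * x))"

definition sigma3 :: "complex \<Rightarrow> complex" where
  "sigma3 z = 1 / csqrt (1 + z) * theta3 ((1 - z) / (1 + z))"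

definition Phi :: real where
  "Phi = Gamma (1 / 4) ^ 8 / (128 * pi ^ 4)"

(* A power series expansion determines its coefficients, so at most one sequence qualifies;
   one exists because sigma3 is holomorphic on the unit disc, even, real on the real axis,
   and theta3 1 and Phi are positive reals. *)
definition theta3_taylor :: "nat \<Rightarrow> real" where
  "theta3_taylor = (THE d. \<forall>z::complex. norm z < 1 \<longrightarrow>
     (\<lambda>n. theta3 1 * (of_real (d n) / fact (2 * n) * of_real Phi ^ n * z ^ (2 * n))) sums sigma3 z)"

definition genfun_U :: "complex \<Rightarrow> complex" where
  "genfun_U t = hyp2F1 (3 / 4) (3 / 4) (3 / 2) (4 * t) / hyp2F1 (1 / 4) (1 / 4) (1 / 2) (4 * t)"

definition genfun_V :: "complex \<Rightarrow> complex" where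
  "genfun_V t = csqrt (hyp2F1 (1 / 4) (1 / 4) (1 / 2) (4 * t))"

end

theory Submission
  imports Defs "HOL-Real_Asymp.Real_Asymp"
begin

text \<open>For real \<open>x > 0\<close> let \<open>k' = \<theta>\<^sub>4(x)\<^sup>2 / \<theta>\<^sub>3(x)\<^sup>2\<close> and \<open>k = \<theta>\<^sub>2(x)\<^sup>2 / \<theta>\<^sub>3(x)\<^sup>2\<close>. The doubling
  formulas of the theta functions are the step of the arithmetic-geometric mean, under which the
  complete elliptic integral is invariant by Gauss's substitution. Doubling \<open>x\<close> for ever gives
  \<open>K = \<pi> \<theta>\<^sub>3(x)\<^sup>2 / 2\<close> and, with the logarithmic growth of the integral, \<open>K' = x K\<close>; Poisson
  summation is not needed. As a function of \<open>w = k\<^sup>2 - k'\<^sup>2\<close>, the even and odd parts of \<open>K\<close> are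
  multiples of \<open>F(1/4, 1/4; 1/2; w\<^sup>2)\<close> and \<open>w F(3/4, 3/4; 3/2; w\<^sup>2)\<close>. Hence \<open>z = (1 - x) / (1 + x)\<close>,
  the quotient \<open>(K - K') / (K + K')\<close>, is a multiple of \<open>w U(w\<^sup>2 / 4)\<close>, while \<open>\<sigma>\<^sub>3(z)\<^sup>2\<close> is a multiple
  of \<open>K + K'\<close>, hence of \<open>V(w\<^sup>2 / 4)\<^sup>2\<close>. This is the asserted identity for real \<open>w\<close>, and analytic
  continuation extends it to the disc \<open>|w| < 1\<close>, which is mapped into the unit disc of \<open>z\<close>. The
  coefficients are unique because \<open>t U(t)\<^sup>2\<close> takes nonzero values arbitrarily close to \<open>0\<close>.\<close>

subsection \<open>Theta functions of a real argument\<close>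

text \<open>The bridge between lattice sums and hypergeometric series is the integral
  \<open>ellP\<close> of y^(-3/4) (1 - y)^(-1/2) (1 - w sqrt y)^(-1/2) over (0, 1). Its Taylor
  coefficients in w are products of binomial coefficients and Beta values, and their two-step
  recurrence separates them into the two series; for real w a rational substitution turns it into K.
  As an integral it also shows what the series conceal. Its values lie in the convex sector |arg| <
  pi/4: hence the even part has positive real part, so that the quotient and the principal root are
  holomorphic, and z cannot leave the disc in which the Taylor series of \<open>sigma3\<close>
  converges. It is strictly increasing in real w, so K'/K determines w; since K'/K = x at the theta
  modulus, exchanging x and 1/x must change the sign of w. The inversion formula of theta_3 and the
  evenness of \<open>sigma3\<close> come out of this. The constant Phi is fixed by 8 kappa^2 Phi =
  1, where kappa w is the linear term of z at w = 0.\<close>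

definition theta_shift :: "real \<Rightarrow> real \<Rightarrow> real" where
  "theta_shift s x = (\<Sum>\<^sub>\<infinity>n\<in>(UNIV :: int set). exp (- pi * (of_int n + s)\<^sup>2 * x))"

lemma summable_on_exp_abs_int:
  fixes c :: real
  assumes "c > 0"
  shows "(\<lambda>n::int. exp (- c * \<bar>of_int n\<bar>)) summable_on UNIV"
proof -
  have geo: "(\<lambda>n. exp (- c * real n)) summable_on (UNIV :: nat set)"
  proof (rule norm_summable_imp_summable_on)
    have "(\<lambda>n. norm (exp (- c * real n) :: real)) = (\<lambda>n. exp (- c) ^ n :: real)"
      by (auto simp: exp_of_nat_mult[symmetric] mult_ac)
    then show "summable (\<lambda>n. norm (exp (- c * real n) :: real))"
      using assms by simp
  qed
  have "(\<lambda>n::int. exp (- c * \<bar>of_int n\<bar>)) summable_on range int"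
    by (subst summable_on_reindex) (use geo in \<open>auto simp: o_def\<close>)
  moreover have "(\<lambda>n::int. exp (- c * \<bar>of_int n\<bar>)) summable_on range (\<lambda>n. - int n)"
    by (subst summable_on_reindex) (use geo in \<open>auto simp: o_def inj_on_def\<close>)
  moreover have "(UNIV :: int set) = range int \<union> range (\<lambda>n. - int n)"
  proof -
    have "z \<in> range int \<union> range (\<lambda>n. - int n)" for z :: int
      by (cases z rule: int_cases2) auto
    then show ?thesis by blast
  qed
  ultimately show ?thesis
    using summable_on_union by metis
qed

lemma abs_le_square_int: "\<bar>real_of_int n\<bar> \<le> (real_of_int n)\<^sup>2"
proof -
  have "\<bar>n\<bar> * 1 \<le> \<bar>n\<bar> * \<bar>n\<bar>"
    by (cases "n = 0", simp, rule mult_left_mono) auto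
  then have "\<bar>n\<bar> \<le> n\<^sup>2" by (simp add: power2_eq_square)
  then show ?thesis
    by (metis of_int_abs of_int_le_iff of_int_power)
qed

lemma theta_shift_summable:
  assumes "x > 0"
  shows "(\<lambda>n::int. exp (- pi * (of_int n + s)\<^sup>2 * x)) summable_on UNIV"
proof (rule summable_on_comparison_test)
  show "(\<lambda>n::int. exp (pi * x * s\<^sup>2) * exp (- (pi * x / 2) * \<bar>of_int n\<bar>)) summable_on UNIV"
    by (intro summable_on_cmult_right summable_on_exp_abs_int) (use assms in auto)
  fix n :: int
  \<comment> \<open>Half of this square is \<open>(n + s)^2 - (n^2 / 2 - s^2)\<close>; together with
    \<open>|n| \<le> n^2\<close> it bounds the Gaussian term by a geometric one.\<close>
  have "0 \<le> (of_int n + 2 * s)\<^sup>2" by simp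
  then have "(of_int n)\<^sup>2 / 2 - s\<^sup>2 \<le> (of_int n + s)\<^sup>2"
    by (simp add: power2_eq_square algebra_simps)
  with abs_le_square_int[of n] have "\<bar>of_int n\<bar> / 2 - s\<^sup>2 \<le> (of_int n + s)\<^sup>2"
    by linarith
  then have "pi * x * (\<bar>of_int n\<bar> / 2 - s\<^sup>2) \<le> pi * x * (of_int n + s)\<^sup>2"
    using assms by (intro mult_left_mono) auto
  then show "exp (- pi * (of_int n + s)\<^sup>2 * x)
      \<le> exp (pi * x * s\<^sup>2) * exp (- (pi * x / 2) * \<bar>of_int n\<bar>)"
    unfolding exp_add[symmetric] exp_le_cancel_iff by (simp add: algebra_simps)
qed auto

lemma theta_shift_has_sum:
  assumes "x > 0"
  shows "((\<lambda>n::int. exp (- pi * (of_int n + s)\<^sup>2 * x)) has_sum theta_shift s x) UNIV"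
  unfolding theta_shift_def using theta_shift_summable[OF assms] by (rule has_sum_infsum)

text \<open>For the square of theta_2: at \<open>s = 1 / 2\<close> the doubling formula produces the
  shift \<open>s + 1 / 2\<close>, a full period.\<close>

lemma theta_shift_plus1: "theta_shift (s + 1) x = theta_shift s x"
  unfolding theta_shift_def
  by (rule infsum_reindex_bij_witness[of _ "\<lambda>n. n - 1" "\<lambda>n. n + 1"]) (auto simp: add_ac)

lemma theta_shift_pos:
  assumes "x > 0"
  shows "theta_shift s x > 0"
proof -
  have "exp (- pi * s\<^sup>2 * x) = infsum (\<lambda>n::int. exp (- pi * (of_int n + s)\<^sup>2 * x)) {0}"
    by simp
  also have "\<dots> \<le> theta_shift s x"
    unfolding theta_shift_def
    by (rule infsum_mono2[OF _ theta_shift_summable]) (use assms in auto)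
  finally show ?thesis
    using exp_gt_zero less_le_trans by blast
qed

lemma theta_shift_product_has_sum:
  assumes "x > 0"
  shows "((\<lambda>(m::int, n::int). exp (- pi * ((of_int m + s)\<^sup>2 + (of_int n + r)\<^sup>2) * x))
    has_sum (theta_shift s x * theta_shift r x)) UNIV"
proof -
  let ?f = "\<lambda>(m::int, n::int). exp (- pi * ((of_int m + s)\<^sup>2 + (of_int n + r)\<^sup>2) * x)"
  have split: "?f (m, n) = exp (- pi * (of_int m + s)\<^sup>2 * x) * exp (- pi * (of_int n + r)\<^sup>2 * x)"
    for m n by (simp add: exp_add[symmetric] algebra_simps)
  have "(?f has_sum (theta_shift s x * theta_shift r x)) (UNIV \<times> UNIV)"
  proof (rule has_sum_SigmaI)
    show "((\<lambda>n. ?f (m, n)) has_sum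
        (exp (- pi * (of_int m + s)\<^sup>2 * x) * theta_shift r x)) UNIV" for m
      unfolding split by (rule has_sum_cmult_right[OF theta_shift_has_sum[OF assms]])
    show "((\<lambda>m::int. exp (- pi * (of_int m + s)\<^sup>2 * x) * theta_shift r x) has_sum
        theta_shift s x * theta_shift r x) UNIV"
      by (rule has_sum_cmult_left[OF theta_shift_has_sum[OF assms]])
    show "?f summable_on UNIV \<times> UNIV"
    proof (rule summable_on_SigmaI)
      show "((\<lambda>n. ?f (m, n)) has_sum
          (exp (- pi * (of_int m + s)\<^sup>2 * x) * theta_shift r x)) UNIV" for m
        unfolding split by (rule has_sum_cmult_right[OF theta_shift_has_sum[OF assms]])
      show "(\<lambda>m::int. exp (- pi * (of_int m + s)\<^sup>2 * x) * theta_shift r x) summable_on UNIV"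
        by (rule summable_on_cmult_left[OF theta_shift_summable[OF assms]])
    qed auto
  qed
  then show ?thesis by simp
qed

text \<open>The parity of \<^term>\<open>m + n\<close> decides which of the two rotated lattices
  \<^term>\<open>(a + b, a - b)\<close>, \<^term>\<open>(a + b + 1, a - b)\<close> contains \<^term>\<open>(m, n)\<close>.\<close>

lemma theta_shift_square:
  assumes "x > 0"
  shows "(theta_shift s x)\<^sup>2 = theta_shift s (2 * x) * theta_shift 0 (2 * x)
    + theta_shift (s + 1 / 2) (2 * x) * theta_shift (1 / 2) (2 * x)"
proof -
  let ?g = "\<lambda>(m::int, n::int). exp (- pi * ((of_int m + s)\<^sup>2 + (of_int n + s)\<^sup>2) * x)"
  let ?E = "{(m::int, n::int). even (m + n)}" and ?O = "{(m::int, n::int). odd (m + n)}"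
  have x2: "2 * x > 0" using assms by simp
  have "(?g has_sum theta_shift s (2 * x) * theta_shift 0 (2 * x)) ?E"
  proof (rule has_sum_reindex_bij_witness[THEN iffD1])
    show "((\<lambda>(m::int, n::int). exp (- pi * ((of_int m + s)\<^sup>2 + (of_int n + 0)\<^sup>2) * (2 * x)))
        has_sum theta_shift s (2 * x) * theta_shift 0 (2 * x)) UNIV"
      by (rule theta_shift_product_has_sum[OF x2])
  next
    fix p :: "int \<times> int" assume "p \<in> UNIV"
    \<comment> \<open>\<open>(A + B)^2 + (A - B)^2 = 2 * (A^2 + B^2)\<close> with
      \<open>A = a + s\<close>, \<open>B = b\<close>; the factor 2 doubles \<open>x\<close>. On the
      odd lattice below, \<open>A = a + s + 1 / 2\<close> and \<open>B = b + 1 / 2\<close>.\<close>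
    show "?g ((\<lambda>(a, b). (a + b, a - b)) p) =
      (\<lambda>(m::int, n::int). exp (- pi * ((of_int m + s)\<^sup>2 + (of_int n + 0)\<^sup>2) * (2 * x))) p"
      by (cases p) (simp add: power2_eq_square algebra_simps)
  next
    fix p :: "int \<times> int" assume "p \<in> ?E"
    then have "even (fst p + snd p)" by auto
    then have "(fst p + snd p) div 2 + (fst p - snd p) div 2 = fst p"
      "(fst p + snd p) div 2 - (fst p - snd p) div 2 = snd p"
      by presburger+
    then show "(\<lambda>(a, b). (a + b, a - b)) ((\<lambda>(m, n). ((m + n) div 2, (m - n) div 2)) p) = p"
      by (simp add: case_prod_beta)
  next
    fix p :: "int \<times> int" assume "p \<in> UNIV"
    show "(\<lambda>(m, n). ((m + n) div 2, (m - n) div 2)) ((\<lambda>(a, b). (a + b, a - b)) p) = p"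
      by (cases p) simp
  qed auto
  moreover have "(?g has_sum theta_shift (s + 1 / 2) (2 * x) * theta_shift (1 / 2) (2 * x)) ?O"
  proof (rule has_sum_reindex_bij_witness[THEN iffD1])
    show "((\<lambda>(m::int, n::int). exp (- pi * ((of_int m + (s + 1 / 2))\<^sup>2 + (of_int n + 1 / 2)\<^sup>2) * (2 * x)))
        has_sum theta_shift (s + 1 / 2) (2 * x) * theta_shift (1 / 2) (2 * x)) UNIV"
      by (rule theta_shift_product_has_sum[OF x2])
  next
    fix p :: "int \<times> int" assume "p \<in> UNIV"
    show "?g ((\<lambda>(a, b). (a + b + 1, a - b)) p) =
      (\<lambda>(m::int, n::int). exp (- pi * ((of_int m + (s + 1 / 2))\<^sup>2 + (of_int n + 1 / 2)\<^sup>2) * (2 * x))) p"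
      by (cases p) (simp add: power2_eq_square field_simps)
  next
    fix p :: "int \<times> int" assume "p \<in> ?O"
    then have "odd (fst p + snd p)" by auto
    then have "(fst p + snd p - 1) div 2 + (fst p - snd p - 1) div 2 + 1 = fst p"
      "(fst p + snd p - 1) div 2 - (fst p - snd p - 1) div 2 = snd p"
      by presburger+
    then show "(\<lambda>(a, b). (a + b + 1, a - b)) ((\<lambda>(m, n). ((m + n - 1) div 2, (m - n - 1) div 2)) p) = p"
      by (simp add: case_prod_beta)
  next
    fix p :: "int \<times> int" assume "p \<in> UNIV"
    show "(\<lambda>(m, n). ((m + n - 1) div 2, (m - n - 1) div 2)) ((\<lambda>(a, b). (a + b + 1, a - b)) p) = p"
      by (cases p) auto
  qed auto
  ultimately have "(?g has_sum theta_shift s (2 * x) * theta_shift 0 (2 * x)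
      + theta_shift (s + 1 / 2) (2 * x) * theta_shift (1 / 2) (2 * x)) (?E \<union> ?O)"
    by (rule has_sum_Un_disjoint) auto
  moreover have "?E \<union> ?O = UNIV" by auto
  ultimately have "(?g has_sum theta_shift s (2 * x) * theta_shift 0 (2 * x)
      + theta_shift (s + 1 / 2) (2 * x) * theta_shift (1 / 2) (2 * x)) UNIV"
    by (simp only:)
  from has_sum_unique[OF theta_shift_product_has_sum[OF assms] this] show ?thesis
    by (simp only: power2_eq_square)
qed

abbreviation theta3r :: "real \<Rightarrow> real" where "theta3r \<equiv> theta_shift 0"
abbreviation theta2r :: "real \<Rightarrow> real" where "theta2r \<equiv> theta_shift (1 / 2)"

text \<open>Splitting the alternating series \<open>\<Sum> (-1)\<^sup>n exp (- \<pi> n\<^sup>2 x)\<close> by the parity of \<open>n\<close>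
  gives this expression.\<close>

definition theta4r :: "real \<Rightarrow> real" where "theta4r x = theta3r (4 * x) - theta2r (4 * x)"

section \<open>Doubling formulas for theta_2, theta_3 and theta_4\<close>

context
  fixes x :: real assumes x: "x > 0"
begin

lemma theta3r_square: "(theta3r x)\<^sup>2 = (theta3r (2 * x))\<^sup>2 + (theta2r (2 * x))\<^sup>2"
  using theta_shift_square[OF x, of 0] unfolding power2_eq_square[of "theta_shift _ (2 * x)"] by simp

lemma theta2r_square: "(theta2r x)\<^sup>2 = 2 * theta2r (2 * x) * theta3r (2 * x)"
proof -
  have "theta_shift 1 (2 * x) = theta3r (2 * x)"
    using theta_shift_plus1[of 0 "2 * x"] by simp
  then show ?thesis
    using theta_shift_square[OF x, of "1 / 2"] by simp
qed

end

text \<open>The difference at \<open>4 * x\<close> squares to a sum of squares minus a cross term,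
  and the two preceding formulas recognise both as squares at \<open>2 * x\<close>.\<close>

lemma theta4r_square:
  assumes "x > 0"
  shows "(theta4r x)\<^sup>2 = (theta3r (2 * x))\<^sup>2 - (theta2r (2 * x))\<^sup>2"
proof -
  have "(theta4r x)\<^sup>2 = ((theta3r (4 * x))\<^sup>2 + (theta2r (4 * x))\<^sup>2) - 2 * theta2r (4 * x) * theta3r (4 * x)"
    unfolding theta4r_def power2_diff by simp
  also have "\<dots> = (theta3r (2 * x))\<^sup>2 - (theta2r (2 * x))\<^sup>2"
    using theta3r_square[of "2 * x"] theta2r_square[of "2 * x"] assms by simp
  finally show ?thesis .
qed

text \<open>Jacobi's quartic identity. With \<open>A\<close>, \<open>B\<close> the squares of
  theta_3 and theta_2 at \<open>2 * x\<close> it reads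
  \<open>(A + B)^2 = 4 * A * B + (A - B)^2\<close>.\<close>

lemma theta_jacobi:
  assumes "x > 0"
  shows "theta3r x ^ 4 = theta2r x ^ 4 + theta4r x ^ 4"
proof -
  have *: "a ^ 4 = (a\<^sup>2)\<^sup>2" for a :: real by simp
  show ?thesis
    unfolding *[of "theta_shift _ _"] *[of "theta4r _"]
      theta3r_square[OF assms] theta2r_square[OF assms] theta4r_square[OF assms]
    by algebra
qed

text \<open>Doubling \<open>x\<close> performs one step of the arithmetic-geometric mean on the pair
  of squares. The geometric mean rests on the quartic identity at \<open>2 * x\<close>; working with
  squares keeps the sign of \<open>theta4r\<close> out of the statement.\<close>

lemma theta34_mean:
  assumes "x > 0"
  shows "((theta3r x)\<^sup>2 + (theta4r x)\<^sup>2) / 2 = (theta3r (2 * x))\<^sup>2"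
    and "sqrt ((theta3r x)\<^sup>2 * (theta4r x)\<^sup>2) = (theta4r (2 * x))\<^sup>2"
proof -
  show "((theta3r x)\<^sup>2 + (theta4r x)\<^sup>2) / 2 = (theta3r (2 * x))\<^sup>2"
    unfolding theta3r_square[OF assms] theta4r_square[OF assms] by simp
  have "(theta3r x)\<^sup>2 * (theta4r x)\<^sup>2 = theta3r (2 * x) ^ 4 - theta2r (2 * x) ^ 4"
    unfolding theta3r_square[OF assms] theta4r_square[OF assms]
    by (simp add: power2_eq_square power4_eq_xxxx algebra_simps)
  also have "\<dots> = ((theta4r (2 * x))\<^sup>2)\<^sup>2"
    using theta_jacobi[of "2 * x"] assms by simp
  finally show "sqrt ((theta3r x)\<^sup>2 * (theta4r x)\<^sup>2) = (theta4r (2 * x))\<^sup>2"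
    by (simp only: real_sqrt_abs abs_power2)
qed

section \<open>Behaviour of the theta functions at infinity\<close>

lemma theta3r_bounds:
  assumes "x \<ge> 1"
  shows "1 \<le> theta3r x" "theta3r x \<le> 1 + theta3r 1 * exp (- pi * (x - 1))"
proof -
  have s: "(\<lambda>n::int. exp (- pi * (of_int n + 0)\<^sup>2 * y)) summable_on A" if "y > 0" for y A
    using theta_shift_summable[OF that] by (rule summable_on_subset) auto
  have "theta3r x = infsum (\<lambda>n::int. exp (- pi * (of_int n + 0)\<^sup>2 * x)) ({0} \<union> - {0})"
    by (simp add: theta_shift_def)
  also have "\<dots> = infsum (\<lambda>n::int. exp (- pi * (of_int n + 0)\<^sup>2 * x)) {0} +
      infsum (\<lambda>n::int. exp (- pi * (of_int n + 0)\<^sup>2 * x)) (- {0})"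
    by (rule infsum_Un_disjoint) (use s assms in auto)
  finally have eq: "theta3r x = 1 + infsum (\<lambda>n::int. exp (- pi * (of_int n + 0)\<^sup>2 * x)) (- {0})"
    by simp
  show "1 \<le> theta3r x"
    unfolding eq by (simp add: infsum_nonneg)
  have "infsum (\<lambda>n::int. exp (- pi * (of_int n + 0)\<^sup>2 * x)) (- {0})
      \<le> infsum (\<lambda>n::int. exp (- pi * (of_int n + 0)\<^sup>2 * 1) * exp (- pi * (x - 1))) (- {0})"
  proof (rule infsum_mono)
    fix n :: int assume "n \<in> - {0}"
    then have "1 \<le> (of_int n :: real)\<^sup>2"
      using abs_le_square_int[of n]
      by (metis ComplD int_one_le_iff_zero_less insertI1 nle_le of_int_1_le_iff of_int_abs order_trans zero_less_abs_iff)
    then have "1 * (x - 1) \<le> (of_int n :: real)\<^sup>2 * (x - 1)"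
      using assms by (intro mult_right_mono) auto
    then have "pi * (x - 1) \<le> pi * ((of_int n :: real)\<^sup>2 * (x - 1))"
      by (intro mult_left_mono) auto
    then show "exp (- pi * (of_int n + 0)\<^sup>2 * x) \<le> exp (- pi * (of_int n + 0)\<^sup>2 * 1) * exp (- pi * (x - 1))"
      unfolding exp_add[symmetric] exp_le_cancel_iff by (simp add: algebra_simps)
  qed (intro summable_on_cmult_left s; use assms in simp)+
  also have "\<dots> \<le> theta3r 1 * exp (- pi * (x - 1))"
    unfolding theta_shift_def infsum_cmult_left'
    by (intro mult_right_mono infsum_mono2 s) auto
  finally show "theta3r x \<le> 1 + theta3r 1 * exp (- pi * (x - 1))"
    unfolding eq by simp
qed

text \<open>Lower and upper bound decay at the same rate \<open>exp (- pi * x / 4)\<close>, that of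
  the indices 0 and -1. The elliptic integral sees the logarithm of \<open>theta2r\<close>, and this
  rate becomes the factor \<open>x\<close> in K' = x K.\<close>

lemma theta2r_bounds:
  assumes "x \<ge> 1"
  shows "exp (- pi * x / 4) \<le> theta2r x" "theta2r x \<le> theta2r 1 * exp (- pi * (x - 1) / 4)"
proof -
  have "exp (- pi * x / 4) = infsum (\<lambda>n::int. exp (- pi * (of_int n + 1 / 2)\<^sup>2 * x)) {0}"
    by (simp add: power2_eq_square)
  also have "\<dots> \<le> theta2r x"
    unfolding theta_shift_def
    by (rule infsum_mono2[OF _ theta_shift_summable]) (use assms in auto)
  finally show "exp (- pi * x / 4) \<le> theta2r x" .
  have "theta2r x \<le> infsum (\<lambda>n::int. exp (- pi * (of_int n + 1 / 2)\<^sup>2 * 1) * exp (- pi * (x - 1) / 4)) UNIV"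
    unfolding theta_shift_def
  proof (rule infsum_mono)
    fix n :: int
    have "0 \<le> (of_int n :: real)\<^sup>2 + of_int n"
      using abs_le_square_int[of n] by linarith
    then have "1 / 4 \<le> (of_int n + 1 / 2 :: real)\<^sup>2"
      by (simp add: power2_eq_square algebra_simps)
    then have "1 / 4 * (x - 1) \<le> (of_int n + 1 / 2 :: real)\<^sup>2 * (x - 1)"
      using assms by (intro mult_right_mono) auto
    then have "pi * (1 / 4 * (x - 1)) \<le> pi * ((of_int n + 1 / 2 :: real)\<^sup>2 * (x - 1))"
      by (intro mult_left_mono) auto
    then have "- pi * (of_int n + 1 / 2)\<^sup>2 * x \<le> - pi * (of_int n + 1 / 2)\<^sup>2 * 1 + - pi * (x - 1) / 4"
      by argo
    then show "exp (- pi * (of_int n + 1 / 2)\<^sup>2 * x) \<le> exp (- pi * (of_int n + 1 / 2)\<^sup>2 * 1) * exp (- pi * (x - 1) / 4)"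
      unfolding exp_add[symmetric] exp_le_cancel_iff .
  qed (intro summable_on_cmult_left theta_shift_summable; use assms in simp)+
  then show "theta2r x \<le> theta2r 1 * exp (- pi * (x - 1) / 4)"
    unfolding infsum_cmult_left' theta_shift_def .
qed

lemma theta3r_tendsto: "(theta3r \<longlongrightarrow> 1) at_top"
proof (rule tendsto_sandwich)
  show "\<forall>\<^sub>F x in at_top. 1 \<le> theta3r x"
    using eventually_ge_at_top[of 1] by eventually_elim (rule theta3r_bounds)
  show "\<forall>\<^sub>F x in at_top. theta3r x \<le> 1 + theta3r 1 * exp (- pi * (x - 1))"
    using eventually_ge_at_top[of 1] by eventually_elim (rule theta3r_bounds)
  show "((\<lambda>x. 1 + theta3r 1 * exp (- pi * (x - 1))) \<longlongrightarrow> 1) at_top"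
    by real_asymp
qed auto

lemma theta2r_tendsto: "(theta2r \<longlongrightarrow> 0) at_top"
proof (rule tendsto_sandwich)
  show "\<forall>\<^sub>F x in at_top. 0 \<le> theta2r x"
    using eventually_gt_at_top[of 0] by eventually_elim (simp add: theta_shift_pos less_imp_le)
  show "\<forall>\<^sub>F x in at_top. theta2r x \<le> theta2r 1 * exp (- pi * (x - 1) / 4)"
    using eventually_ge_at_top[of 1] by eventually_elim (rule theta2r_bounds)
  show "((\<lambda>x. theta2r 1 * exp (- pi * (x - 1) / 4)) \<longlongrightarrow> 0) at_top"
    by real_asymp
qed auto

lemma theta4r_tendsto: "(theta4r \<longlongrightarrow> 1) at_top"
proof -
  have *: "filterlim (\<lambda>x::real. 4 * x) at_top at_top" by real_asymp
  show ?thesis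
    unfolding theta4r_def
    using tendsto_diff[OF filterlim_compose[OF theta3r_tendsto *] filterlim_compose[OF theta2r_tendsto *]]
    by simp
qed

lemma filterlim_doubling:
  assumes "(x::real) > 0"
  shows "filterlim (\<lambda>n. 2 ^ n * x) at_top sequentially"
  using assms by real_asymp

text \<open>Through the geometric mean a zero at \<open>x\<close> would propagate to all
  \<open>2 ^ n * x\<close>, against the limit 1 at infinity.\<close>

lemma theta4r_nonzero:
  assumes "x > 0"
  shows "theta4r x \<noteq> 0"
proof
  assume *: "theta4r x = 0"
  have "theta4r (2 ^ n * x) = 0" for n
  proof (induction n)
    case (Suc n)
    with theta34_mean(2)[of "2 ^ n * x"] assms show ?case by (simp add: mult_ac)
  qed (use * in simp)
  then have "(\<lambda>n. theta4r (2 ^ n * x)) \<longlonglongrightarrow> 0" by simp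
  moreover have "(\<lambda>n. theta4r (2 ^ n * x)) \<longlonglongrightarrow> 1"
    by (rule filterlim_compose[OF theta4r_tendsto filterlim_doubling[OF assms]])
  ultimately show False
    using LIMSEQ_unique by force
qed

subsection \<open>Complete elliptic integrals\<close>

definition ell :: "real \<Rightarrow> real \<Rightarrow> real \<Rightarrow> real" where
  "ell a b t = 1 / sqrt ((t\<^sup>2 + a\<^sup>2) * (t\<^sup>2 + b\<^sup>2))"

text \<open>For positive \<open>a\<close> and \<open>b\<close>, the substitution
  \<open>t = b * tan phi\<close> gives Gauss's integral of
  \<open>1 / sqrt (a^2 * cos^2 phi + b^2 * sin^2 phi)\<close> over a quarter period. In particular
  \<open>ellint 1 k'\<close> is the complete integral K.\<close>

definition ellint :: "real \<Rightarrow> real \<Rightarrow> real" where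
  "ellint a b = (LBINT t=0..\<infinity>. ell a b t)"

lemma ell_commute: "ell a b t = ell b a t"
  by (simp add: ell_def mult_ac)

lemma ellint_commute: "ellint a b = ellint b a"
  by (simp add: ellint_def ell_commute[of a b])

lemma ell_minus [simp]: "ell a b (- t) = ell a b t"
  by (simp add: ell_def)

lemma ell_nonneg: "ell a b t \<ge> 0"
  by (simp add: ell_def)

lemma isCont_ell: "a > 0 \<Longrightarrow> b > 0 \<Longrightarrow> isCont (ell a b) t"
  unfolding ell_def
  by (intro continuous_intros) (auto simp: add_nonneg_eq_0_iff)

lemma borel_measurable_ell [measurable]: "ell a b \<in> borel_measurable borel"
  unfolding ell_def by measurable

lemma ell_le:
  assumes "0 < b" "b \<le> a"
  shows "ell a b t \<le> 1 / (t\<^sup>2 + b\<^sup>2)"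
proof -
  have "b\<^sup>2 \<le> a\<^sup>2" using assms by (intro power_mono) auto
  then have "(t\<^sup>2 + b\<^sup>2)\<^sup>2 \<le> (t\<^sup>2 + a\<^sup>2) * (t\<^sup>2 + b\<^sup>2)"
    unfolding power2_eq_square[of "t\<^sup>2 + b\<^sup>2"] by (intro mult_right_mono) auto
  then have "t\<^sup>2 + b\<^sup>2 \<le> sqrt ((t\<^sup>2 + a\<^sup>2) * (t\<^sup>2 + b\<^sup>2))"
    by (rule real_le_rsqrt)
  moreover have "t\<^sup>2 + b\<^sup>2 > 0" "t\<^sup>2 + a\<^sup>2 > 0" using assms by (simp_all add: add_nonneg_pos)
  ultimately show ?thesis
    unfolding ell_def by (intro divide_left_mono mult_pos_pos) auto
qed

lemma ell_ge:
  assumes "0 < b" "b \<le> a"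
  shows "1 / (t\<^sup>2 + a\<^sup>2) \<le> ell a b t"
proof -
  have "b\<^sup>2 \<le> a\<^sup>2" using assms by (intro power_mono) auto
  then have "(t\<^sup>2 + a\<^sup>2) * (t\<^sup>2 + b\<^sup>2) \<le> (t\<^sup>2 + a\<^sup>2)\<^sup>2"
    unfolding power2_eq_square[of "t\<^sup>2 + a\<^sup>2"] by (intro mult_left_mono) auto
  then have "sqrt ((t\<^sup>2 + a\<^sup>2) * (t\<^sup>2 + b\<^sup>2)) \<le> t\<^sup>2 + a\<^sup>2"
    by (intro real_le_lsqrt) auto
  moreover have "t\<^sup>2 + a\<^sup>2 > 0" "t\<^sup>2 + b\<^sup>2 > 0" using assms by (simp_all add: add_nonneg_pos)
  ultimately show ?thesis
    unfolding ell_def by (intro divide_left_mono mult_pos_pos) auto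
qed

lemma inverse_square_plus_square:
  assumes "c > 0"
  shows "set_integrable lborel (einterval 0 \<infinity>) (\<lambda>t. 1 / (t\<^sup>2 + c\<^sup>2))"
    and "(LBINT t=0..\<infinity>. 1 / (t\<^sup>2 + c\<^sup>2)) = pi / (2 * c)"
    and "set_integrable lborel (einterval (-\<infinity>) \<infinity>) (\<lambda>t. 1 / (t\<^sup>2 + c\<^sup>2))"
proof -
  let ?F = "\<lambda>t. arctan (t / c) / c"
  have nz: "t\<^sup>2 + c\<^sup>2 \<noteq> 0" for t
    using assms by (simp add: add_nonneg_eq_0_iff)
  have D: "DERIV ?F t :> 1 / (t\<^sup>2 + c\<^sup>2)" for t
  proof -
    have "1 + (t / c)\<^sup>2 = (t\<^sup>2 + c\<^sup>2) / c\<^sup>2"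
      using assms by (simp add: field_simps)
    then have "inverse (1 + (t / c)\<^sup>2) * (1 / c) / c = 1 / (t\<^sup>2 + c\<^sup>2)"
      using assms by (simp add: power2_eq_square)
    then show ?thesis
      using assms by (auto intro!: derivative_eq_intros)
  qed
  have C: "isCont (\<lambda>t. 1 / (t\<^sup>2 + c\<^sup>2)) t" for t
    using nz by (auto intro!: continuous_intros)
  have at0: "((?F \<circ> real_of_ereal) \<longlongrightarrow> 0) (at_right 0)"
    using assms by (auto simp: zero_ereal_def ereal_tendsto_simps intro!: tendsto_eq_intros)
  have atp: "((?F \<circ> real_of_ereal) \<longlongrightarrow> pi / 2 / c) (at_left \<infinity>)"
    unfolding ereal_tendsto_simps
    by (intro tendsto_divide tendsto_const filterlim_compose[OF tendsto_arctan_at_top])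
       (use assms in real_asymp, use assms in simp)
  have atm: "((?F \<circ> real_of_ereal) \<longlongrightarrow> (- pi / 2) / c) (at_right (-\<infinity>))"
    unfolding ereal_tendsto_simps
    by (intro tendsto_divide tendsto_const filterlim_compose[OF tendsto_arctan_at_bot, unfolded minus_divide_left])
       (use assms in real_asymp, use assms in simp)
  show "set_integrable lborel (einterval 0 \<infinity>) (\<lambda>t. 1 / (t\<^sup>2 + c\<^sup>2))"
    by (rule interval_integral_FTC_nonneg(1)[OF _ D C _ at0 atp]) auto
  have "(LBINT t=0..\<infinity>. 1 / (t\<^sup>2 + c\<^sup>2)) = pi / 2 / c - 0"
    by (rule interval_integral_FTC_nonneg(2)[OF _ D C _ at0 atp]) auto
  then show "(LBINT t=0..\<infinity>. 1 / (t\<^sup>2 + c\<^sup>2)) = pi / (2 * c)" by simp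
  show "set_integrable lborel (einterval (-\<infinity>) \<infinity>) (\<lambda>t. 1 / (t\<^sup>2 + c\<^sup>2))"
    by (rule interval_integral_FTC_nonneg(1)[OF _ D C _ atm atp]) auto
qed

lemma set_integrable_ell_UNIV:
  assumes "a > 0" "b > 0"
  shows "set_integrable lborel (einterval (-\<infinity>) \<infinity>) (ell a b)"
proof -
  define c where "c = min a b"
  have c: "c > 0" using assms by (simp add: c_def)
  have le: "ell a b t \<le> 1 / (t\<^sup>2 + c\<^sup>2)" for t
    using ell_le[of b a t] ell_le[of a b t] ell_commute[of a b t] assms
    by (cases "b \<le> a") (auto simp: c_def)
  show ?thesis
    by (rule set_integrable_bound[OF inverse_square_plus_square(3)[OF c]])
       (use le in \<open>auto simp: ell_nonneg set_borel_measurable_def\<close>)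
qed

lemma set_integrable_ell:
  assumes "a > 0" "b > 0" "A \<in> sets borel"
  shows "set_integrable lborel A (ell a b)"
  using set_integrable_ell_UNIV[OF assms(1,2)]
  by (rule set_integrable_subset) (use assms in \<open>auto simp: einterval_def\<close>)

lemma ellint_eq_set_integral: "ellint a b = (LBINT t:{0<..}. ell a b t)"
  by (simp add: ellint_def interval_lebesgue_integral_0_infty)

text \<open>Both parameters are replaced by the larger or by the smaller one, which leaves an
  arctangent integral. This squeezes the integral once the two parameters approach a common
  limit.\<close>

lemma ellint_bounds:
  assumes "0 < b" "b \<le> a"
  shows "pi / (2 * a) \<le> ellint a b" "ellint a b \<le> pi / (2 * b)"
proof -
  have a: "a > 0" using assms by simp
  have e: "einterval 0 \<infinity> = {0<..}" by (auto simp: einterval_def)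
  have I: "(LBINT t:{0<..}. 1 / (t\<^sup>2 + c\<^sup>2)) = pi / (2 * c)"
    "set_integrable lborel {0<..} (\<lambda>t. 1 / (t\<^sup>2 + c\<^sup>2))" if "c > 0" for c :: real
    using inverse_square_plus_square(1,2)[OF that] e by (simp_all add: interval_lebesgue_integral_0_infty)
  show "pi / (2 * a) \<le> ellint a b"
    unfolding ellint_eq_set_integral I(1)[OF a, symmetric]
    by (rule set_integral_mono) (use assms a I ell_ge set_integrable_ell in auto)
  show "ellint a b \<le> pi / (2 * b)"
    unfolding ellint_eq_set_integral I(1)[OF assms(1), symmetric]
    by (rule set_integral_mono) (use assms a I ell_le set_integrable_ell in auto)
qed

lemma ellint_scale:
  assumes "c > 0" "a > 0" "b > 0"
  shows "ellint (c * a) (c * b) = ellint a b / c"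
proof -
  have eq: "ell (c * a) (c * b) (c * t) = ell a b t / c\<^sup>2" for t
  proof -
    have "((c * t)\<^sup>2 + (c * a)\<^sup>2) * ((c * t)\<^sup>2 + (c * b)\<^sup>2) = (c\<^sup>2)\<^sup>2 * ((t\<^sup>2 + a\<^sup>2) * (t\<^sup>2 + b\<^sup>2))"
      by (simp add: power2_eq_square algebra_simps)
    then show ?thesis
      unfolding ell_def by (simp only: real_sqrt_mult real_sqrt_abs) (simp add: real_sqrt_mult)
  qed
  have eq': "ell (c * a) (c * b) (c * t) * c = (1 / c) * ell a b t" for t
    unfolding eq using assms by (simp add: power2_eq_square)
  have "ellint (c * a) (c * b) = (LBINT t=0..\<infinity>. ell (c * a) (c * b) (c * t) * c)"
    unfolding ellint_def
  proof (rule interval_integral_substitution_nonneg(2))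
    show "((ereal \<circ> (*) c \<circ> real_of_ereal) \<longlongrightarrow> 0) (at_right 0)"
      by (auto simp: zero_ereal_def ereal_tendsto_simps intro!: tendsto_eq_intros)
    show "((ereal \<circ> (*) c \<circ> real_of_ereal) \<longlongrightarrow> \<infinity>) (at_left \<infinity>)"
      unfolding ereal_tendsto_simps using assms by real_asymp
    show "set_integrable lborel (einterval 0 \<infinity>) (\<lambda>x. ell (c * a) (c * b) (c * x) * c)"
      unfolding eq' by (intro set_integrable_mult_right set_integrable_ell) (use assms in auto)
  qed (use assms in \<open>auto intro!: derivative_eq_intros isCont_ell simp: ell_nonneg\<close>)
  also have "\<dots> = ellint a b / c"
    unfolding eq' ellint_def by simp
  finally show ?thesis .
qed

lemma ellint_even:
  assumes "a > 0" "b > 0"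
  shows "(LBINT t=-\<infinity>..\<infinity>. ell a b t) = 2 * ellint a b"
proof -
  have "(LBINT t=-\<infinity>..\<infinity>. ell a b t) = (LBINT t=-\<infinity>..0. ell a b t) + (LBINT t=0..\<infinity>. ell a b t)"
    by (rule interval_integral_sum[symmetric])
       (use set_integrable_ell_UNIV[OF assms] in \<open>auto simp: interval_lebesgue_integrable_def\<close>)
  also have "(LBINT t=-\<infinity>..0. ell a b t) = ellint a b"
    unfolding ellint_def by (subst interval_integral_reflect) simp
  finally show ?thesis by (simp add: ellint_def)
qed

text \<open>The map \<open>t \<mapsto> (t - a * b / t) / 2\<close> increases from (0, \<infinity>)
  onto the whole line and pulls the integrand of the two means back to twice the integrand of
  \<open>a\<close>, \<open>b\<close>. The same factor 2 arises on the other side, because the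
  integrand over the line is even.\<close>

lemma ellint_gauss:
  assumes "a > 0" "b > 0"
  shows "ellint ((a + b) / 2) (sqrt (a * b)) = ellint a b"
proof -
  let ?g = "\<lambda>t. (t - a * b / t) / 2" and ?g' = "\<lambda>t. (1 + a * b / t\<^sup>2) / 2"
  let ?h = "ell ((a + b) / 2) (sqrt (a * b))"
  have pos: "sqrt (a * b) > 0" "(a + b) / 2 > 0" using assms by auto
  have eq: "?h (?g t) * ?g' t = 2 * ell a b t" if "t > 0" for t
  proof -
    let ?R = "(t\<^sup>2 + a\<^sup>2) * (t\<^sup>2 + b\<^sup>2)"
    \<comment> \<open>One quadratic factor becomes a perfect square, whose root cancels against the
      derivative of the map; the other splits into the two factors belonging to \<open>a\<close> and
      \<open>b\<close>.\<close>
    have 1: "(?g t)\<^sup>2 + (sqrt (a * b))\<^sup>2 = ((t\<^sup>2 + a * b) / (2 * t))\<^sup>2"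
      using assms that by (simp add: field_simps power2_eq_square)
    have 2: "(?g t)\<^sup>2 + ((a + b) / 2)\<^sup>2 = ?R / (2 * t)\<^sup>2"
      using assms that by (simp add: field_simps power2_eq_square)
    have 3: "t\<^sup>2 + a * b > 0" using assms by (simp add: add_nonneg_pos)
    have "?h (?g t) = 1 / (sqrt ?R / (2 * t) * ((t\<^sup>2 + a * b) / (2 * t)))"
      unfolding ell_def 1 2 using that 3 assms
      by (simp add: real_sqrt_mult real_sqrt_divide)
    also have "\<dots> = 4 * t\<^sup>2 / (sqrt ?R * (t\<^sup>2 + a * b))"
      using that by (simp add: power2_eq_square)
    also have "\<dots> * ?g' t = 2 * ell a b t"
    proof -
      have "?g' t = (t\<^sup>2 + a * b) / (2 * t\<^sup>2)"
        using that by (simp add: field_simps)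
      moreover have "4 * u / (r * q) * (q / (2 * u)) = 2 * (1 / r)" if "q > 0" "u > 0" for u r q :: real
        using that by simp
      ultimately show ?thesis
        using 3 that by (simp only: ell_def) simp
    qed
    finally show ?thesis .
  qed
  have "(LBINT t=-\<infinity>..\<infinity>. ?h t) = (LBINT t=0..\<infinity>. ?h (?g t) * ?g' t)"
  proof (rule interval_integral_substitution_nonneg(2))
    show "((ereal \<circ> ?g \<circ> real_of_ereal) \<longlongrightarrow> -\<infinity>) (at_right 0)"
      unfolding zero_ereal_def ereal_tendsto_simps using assms by real_asymp
    show "((ereal \<circ> ?g \<circ> real_of_ereal) \<longlongrightarrow> \<infinity>) (at_left \<infinity>)"
      unfolding ereal_tendsto_simps using assms by real_asymp
    have "set_integrable lborel (einterval 0 \<infinity>) (\<lambda>t. 2 * ell a b t)"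
      by (intro set_integrable_mult_right set_integrable_ell) (use assms in auto)
    also have "?this \<longleftrightarrow> set_integrable lborel (einterval 0 \<infinity>) (\<lambda>t. ?h (?g t) * ?g' t)"
    proof (rule set_integrable_cong)
      fix t :: real assume "t \<in> einterval 0 \<infinity>"
      then have "t > 0" by (simp add: einterval_def)
      then show "2 * ell a b t = ?h (?g t) * ?g' t" by (rule eq[symmetric])
    qed auto
    finally show "set_integrable lborel (einterval 0 \<infinity>) (\<lambda>t. ?h (?g t) * ?g' t)" .
    show "DERIV ?g t :> ?g' t" if "0 < ereal t" for t
      using that by (auto intro!: derivative_eq_intros simp: power2_eq_square field_simps)
  qed (use assms in \<open>auto intro!: continuous_intros isCont_ell simp: ell_nonneg\<close>)
  also have "\<dots> = (LBINT t=0..\<infinity>. 2 * ell a b t)"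
  proof (rule interval_integral_cong)
    fix t :: real assume "t \<in> einterval (min 0 \<infinity>) (max 0 \<infinity>)"
    then have "t > 0" by (simp add: einterval_def)
    then show "?h (?g t) * ?g' t = 2 * ell a b t" by (rule eq)
  qed
  finally show ?thesis
    using ellint_even[OF pos(2,1)] by (simp add: ellint_def)
qed

section \<open>Logarithmic growth of the elliptic integral as one parameter tends to 0\<close>

lemma arsinh_integral:
  assumes "b > 0" "T > 0"
  shows "set_integrable lborel {0<..<T} (\<lambda>t. 1 / sqrt (t\<^sup>2 + b\<^sup>2))"
    and "(LBINT t:{0<..<T}. 1 / sqrt (t\<^sup>2 + b\<^sup>2)) = arsinh (T / b)"
proof -
  let ?F = "\<lambda>t. arsinh (t / b)"
  have pos: "t\<^sup>2 + b\<^sup>2 > 0" for t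
    using assms by (simp add: add_nonneg_pos)
  have D: "DERIV ?F t :> 1 / sqrt (t\<^sup>2 + b\<^sup>2)" for t
  proof -
    have "(t / b)\<^sup>2 + 1 = (t\<^sup>2 + b\<^sup>2) / b\<^sup>2"
      using assms by (simp add: field_simps)
    then have "sqrt ((t / b)\<^sup>2 + 1) = sqrt (t\<^sup>2 + b\<^sup>2) / b"
      using assms by (simp add: real_sqrt_divide)
    then have "1 / sqrt ((t / b)\<^sup>2 + 1) * (1 / b) = 1 / sqrt (t\<^sup>2 + b\<^sup>2)"
      using assms by simp
    moreover have "DERIV ?F t :> 1 / sqrt ((t / b)\<^sup>2 + 1) * (1 / b)"
      by (rule DERIV_chain2[OF arsinh_real_has_field_derivative])
         (use assms in \<open>auto intro!: derivative_eq_intros\<close>)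
    ultimately show ?thesis by simp
  qed
  have C: "isCont (\<lambda>t. 1 / sqrt (t\<^sup>2 + b\<^sup>2)) t" for t
    using pos[of t] by (auto intro!: continuous_intros)
  have at0: "((?F \<circ> real_of_ereal) \<longlongrightarrow> 0) (at_right 0)"
    using assms by (auto simp: zero_ereal_def ereal_tendsto_simps intro!: tendsto_eq_intros)
  have atT: "((?F \<circ> real_of_ereal) \<longlongrightarrow> arsinh (T / b)) (at_left (ereal T))"
    using assms by (auto simp: ereal_tendsto_simps intro!: tendsto_eq_intros)
  have e: "einterval 0 (ereal T) = {0<..<T}" by (auto simp: einterval_def)
  have "set_integrable lborel (einterval 0 (ereal T)) (\<lambda>t. 1 / sqrt (t\<^sup>2 + b\<^sup>2))"
    by (rule interval_integral_FTC_nonneg(1)[OF _ D C _ at0 atT]) (use assms in \<open>auto simp: zero_ereal_def\<close>)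
  then show "set_integrable lborel {0<..<T} (\<lambda>t. 1 / sqrt (t\<^sup>2 + b\<^sup>2))" unfolding e .
  have "(LBINT t=0..ereal T. 1 / sqrt (t\<^sup>2 + b\<^sup>2)) = arsinh (T / b) - 0"
    by (rule interval_integral_FTC_nonneg(2)[OF _ D C _ at0 atT]) (use assms in \<open>auto simp: zero_ereal_def\<close>)
  then show "(LBINT t:{0<..<T}. 1 / sqrt (t\<^sup>2 + b\<^sup>2)) = arsinh (T / b)"
    using assms by (simp add: interval_lebesgue_integral_def e zero_ereal_def)
qed

lemma inverse_square_tail:
  shows "set_integrable lborel {1<..} (\<lambda>t::real. 1 / t\<^sup>2)"
    and "(LBINT t:{1<..}. 1 / t\<^sup>2) = (1 :: real)"
proof -
  let ?F = "\<lambda>t::real. - 1 / t"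
  have D: "DERIV ?F t :> 1 / t\<^sup>2" if "1 < ereal t" for t
    using that by (auto intro!: derivative_eq_intros simp: power2_eq_square)
  have C: "isCont (\<lambda>t. 1 / t\<^sup>2) t" if "1 < ereal t" for t :: real
    using that by (auto intro!: continuous_intros)
  have at1: "((?F \<circ> real_of_ereal) \<longlongrightarrow> - 1) (at_right 1)"
    by (auto simp: one_ereal_def ereal_tendsto_simps intro!: tendsto_eq_intros)
  have ati: "((?F \<circ> real_of_ereal) \<longlongrightarrow> 0) (at_left \<infinity>)"
    unfolding ereal_tendsto_simps by real_asymp
  have e: "einterval 1 \<infinity> = {1<..}" by (auto simp: einterval_def one_ereal_def)
  have "set_integrable lborel (einterval 1 \<infinity>) (\<lambda>t::real. 1 / t\<^sup>2)"
    by (rule interval_integral_FTC_nonneg(1)[OF _ D C _ at1 ati]) auto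
  then show "set_integrable lborel {1<..} (\<lambda>t::real. 1 / t\<^sup>2)" unfolding e .
  have "(LBINT t=1..\<infinity>. 1 / t\<^sup>2) = 0 - (- 1 :: real)"
    by (rule interval_integral_FTC_nonneg(2)[OF _ D C _ at1 ati]) auto
  then show "(LBINT t:{1<..}. 1 / t\<^sup>2) = (1 :: real)"
    by (simp add: interval_lebesgue_integral_def e)
qed

text \<open>On (0, T) the factor with \<open>a\<close> is at most its value at \<open>T\<close>, and
  the factor with \<open>b\<close> integrates to an arsinh. The cut \<open>T\<close> stays free so
  that the loss \<open>sqrt (T^2 + a^2)\<close> can be brought arbitrarily close to
  \<open>a\<close>.\<close>

lemma ellint_ge_arsinh:
  assumes "a > 0" "b > 0" "T > 0"
  shows "arsinh (T / b) / sqrt (T\<^sup>2 + a\<^sup>2) \<le> ellint a b"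
proof -
  have "arsinh (T / b) / sqrt (T\<^sup>2 + a\<^sup>2) =
      (LBINT t:{0<..<T}. 1 / sqrt (t\<^sup>2 + b\<^sup>2) * (1 / sqrt (T\<^sup>2 + a\<^sup>2)))"
    by (subst set_integral_mult_left) (simp add: arsinh_integral(2)[OF assms(2,3)])
  also have "\<dots> \<le> (LBINT t:{0<..<T}. ell a b t)"
  proof (rule set_integral_mono)
    show "set_integrable lborel {0<..<T} (\<lambda>t. 1 / sqrt (t\<^sup>2 + b\<^sup>2) * (1 / sqrt (T\<^sup>2 + a\<^sup>2)))"
      by (intro set_integrable_mult_left arsinh_integral assms)
    show "set_integrable lborel {0<..<T} (ell a b)"
      by (rule set_integrable_ell) (use assms in auto)
    fix t assume t: "t \<in> {0<..<T}"
    then have "sqrt (t\<^sup>2 + a\<^sup>2) \<le> sqrt (T\<^sup>2 + a\<^sup>2)"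
      by (auto intro!: power_mono)
    moreover have "sqrt (t\<^sup>2 + a\<^sup>2) > 0" "sqrt (t\<^sup>2 + b\<^sup>2) > 0"
      using assms t by (simp_all add: add_nonneg_pos)
    ultimately show "1 / sqrt (t\<^sup>2 + b\<^sup>2) * (1 / sqrt (T\<^sup>2 + a\<^sup>2)) \<le> ell a b t"
      unfolding ell_def real_sqrt_mult by (auto simp: field_simps intro!: mult_left_mono)
  qed
  also have "\<dots> \<le> ellint a b"
    unfolding ellint_eq_set_integral set_lebesgue_integral_def
  proof (rule integral_mono)
    show "indicat_real {0<..<T} t *\<^sub>R ell a b t \<le> indicat_real {0<..} t *\<^sub>R ell a b t" for t
      by (auto simp: indicator_def ell_nonneg)
  qed (use set_integrable_ell[OF assms(1,2), unfolded set_integrable_def] in auto)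
  finally show ?thesis .
qed

text \<open>Below 1 the factor with \<open>a\<close> is at least \<open>a\<close>; beyond 1 the
  integrand is at most \<open>1 / t^2\<close>, which contributes only the bounded error 1.\<close>

lemma ellint_le_arsinh:
  assumes "a > 0" "b > 0"
  shows "ellint a b \<le> arsinh (1 / b) / a + 1"
proof -
  have "ellint a b \<le> (LBINT t:{0<..<1} \<union> {1<..}. ell a b t)"
    unfolding ellint_eq_set_integral
  proof (rule eq_refl, rule set_integral_cong_set)
    have "AE t in lborel. t \<noteq> (1::real)" by (rule AE_lborel_singleton)
    then show "AE t in lborel. (t \<in> {0<..<1} \<union> {1<..}) = (t \<in> {0::real<..})"
      by eventually_elim auto
  qed (auto simp: set_borel_measurable_def)
  also have "\<dots> = (LBINT t:{0<..<1}. ell a b t) + (LBINT t:{1<..}. ell a b t)"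
    by (rule set_integral_Un) (use assms set_integrable_ell in auto)
  also have "(LBINT t:{0<..<1}. ell a b t) \<le> (LBINT t:{0<..<1}. 1 / sqrt (t\<^sup>2 + b\<^sup>2) * (1 / a))"
  proof (rule set_integral_mono)
    show "set_integrable lborel {0<..<1} (\<lambda>t. 1 / sqrt (t\<^sup>2 + b\<^sup>2) * (1 / a))"
      by (intro set_integrable_mult_left arsinh_integral assms) auto
    show "set_integrable lborel {0<..<1} (ell a b)"
      by (rule set_integrable_ell) (use assms in auto)
    fix t :: real assume t: "t \<in> {0<..<1}"
    have "a \<le> sqrt (t\<^sup>2 + a\<^sup>2)"
      by (intro real_le_rsqrt) auto
    moreover have "sqrt (t\<^sup>2 + a\<^sup>2) > 0" "sqrt (t\<^sup>2 + b\<^sup>2) > 0"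
      using assms t by (simp_all add: add_nonneg_pos)
    ultimately show "ell a b t \<le> 1 / sqrt (t\<^sup>2 + b\<^sup>2) * (1 / a)"
      unfolding ell_def real_sqrt_mult using assms by (auto simp: field_simps intro!: mult_left_mono)
  qed
  also have "(LBINT t:{0<..<1}. 1 / sqrt (t\<^sup>2 + b\<^sup>2) * (1 / a)) = arsinh (1 / b) / a"
    by (subst set_integral_mult_left) (simp add: arsinh_integral(2)[OF assms(2)])
  also have "(LBINT t:{1<..}. ell a b t) \<le> (LBINT t:{1<..}. 1 / t\<^sup>2)"
  proof (rule set_integral_mono)
    show "set_integrable lborel {1<..} (\<lambda>t::real. 1 / t\<^sup>2)" by (rule inverse_square_tail)
    show "set_integrable lborel {1<..} (ell a b)"
      by (rule set_integrable_ell) (use assms in auto)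
    fix t :: real assume t: "t \<in> {1<..}"
    have "(t\<^sup>2)\<^sup>2 \<le> (t\<^sup>2 + a\<^sup>2) * (t\<^sup>2 + b\<^sup>2)"
      unfolding power2_eq_square[of "t\<^sup>2"] by (intro mult_mono) auto
    then have "t\<^sup>2 \<le> sqrt ((t\<^sup>2 + a\<^sup>2) * (t\<^sup>2 + b\<^sup>2))"
      by (rule real_le_rsqrt)
    then show "ell a b t \<le> 1 / t\<^sup>2"
      unfolding ell_def using t assms by (intro divide_left_mono) (auto simp: add_nonneg_pos)
  qed
  also have "\<dots> = 1" by (rule inverse_square_tail)
  finally show ?thesis by simp
qed

subsection \<open>The elliptic integral as a hypergeometric function\<close>

lemma pochhammer_mono_real:
  assumes "0 \<le> a" "a \<le> (c::real)"
  shows "pochhammer a n \<le> pochhammer c n"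
  unfolding pochhammer_prod by (intro prod_mono) (use assms in auto)

text \<open>Comparing \<open>a\<close> with 1 and \<open>b\<close> with \<open>c\<close> factor by
  factor puts every coefficient into [0, 1], so the geometric series is a majorant.\<close>

lemma hyp2F1_of_real_sums:
  fixes a b c :: real
  assumes "0 \<le> a" "a \<le> 1" "0 \<le> b" "b \<le> c" "0 < c" and z: "norm z < 1"
  shows "(\<lambda>n. of_real (pochhammer a n * pochhammer b n / (pochhammer c n * fact n)) * z ^ n) sums
    hyp2F1 (of_real a) (of_real b) (of_real c) z"
proof -
  let ?k = "\<lambda>n. pochhammer a n * pochhammer b n / (pochhammer c n * fact n)"
  have k: "0 \<le> ?k n" "?k n \<le> 1" for n
  proof -
    have *: "pochhammer c n > 0" "pochhammer a n \<ge> 0" "pochhammer b n \<ge> 0"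
      using assms pochhammer_mono_real[of 0 a n] pochhammer_mono_real[of 0 b n]
      by (auto intro: pochhammer_pos simp: pochhammer_0_left split: if_splits)
    show "0 \<le> ?k n" using * by simp
    have "pochhammer a n \<le> fact n"
      using pochhammer_mono_real[of a 1 n] assms by (simp add: pochhammer_fact)
    moreover have "pochhammer b n \<le> pochhammer c n"
      by (rule pochhammer_mono_real) (use assms in auto)
    ultimately have "pochhammer a n * pochhammer b n \<le> fact n * pochhammer c n"
      using * by (intro mult_mono) auto
    then show "?k n \<le> 1" using * by (simp add: field_simps)
  qed
  have "summable (\<lambda>n. of_real (?k n) * z ^ n)"
  proof (rule summable_comparison_test')
    show "summable (\<lambda>n. norm z ^ n)" using z by simp
    show "norm (of_real (?k n) * z ^ n) \<le> norm z ^ n" if "n \<ge> 0" for n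
    proof -
      have "norm (of_real (?k n) * z ^ n) = ?k n * norm z ^ n"
        using k(1)[of n] by (simp only: norm_mult norm_of_real norm_power abs_of_nonneg)
      then show ?thesis using mult_left_le_one_le[OF _ k] by simp
    qed
  qed
  moreover have "hyp2F1 (of_real a) (of_real b) (of_real c) z = (\<Sum>n. of_real (?k n) * z ^ n)"
    unfolding hyp2F1_def by (intro suminf_cong) (simp add: pochhammer_of_real mult_ac)
  ultimately show ?thesis by (simp add: summable_sums)
qed

lemma hyp2F1_holomorphic:
  fixes a b c :: real
  assumes "0 \<le> a" "a \<le> 1" "0 \<le> b" "b \<le> c" "0 < c"
  shows "hyp2F1 (of_real a) (of_real b) (of_real c) holomorphic_on ball 0 1"
proof -
  let ?f = "\<lambda>n. of_real (pochhammer a n * pochhammer b n / (pochhammer c n * fact n)) :: complex"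
  have "conv_radius ?f \<ge> 1"
  proof (rule conv_radius_geI_ex)
    fix r :: real assume "0 < r" "ereal r < 1"
    then have "norm (of_real r :: complex) = r" "r < 1" by (auto simp: one_ereal_def)
    moreover from this have "summable (\<lambda>n. ?f n * of_real r ^ n)"
      using hyp2F1_of_real_sums[OF assms, of "of_real r"] sums_summable by metis
    ultimately show "\<exists>z. norm z = r \<and> summable (\<lambda>n. ?f n * z ^ n)"
      by blast
  qed
  then have R: "fps_conv_radius (Abs_fps ?f) \<ge> 1"
    by (simp add: fps_conv_radius_def)
  have "ball (0 :: complex) 1 \<subseteq> eball 0 (fps_conv_radius (Abs_fps ?f))"
  proof
    fix z :: complex assume "z \<in> ball 0 1"
    then have "ereal (norm z) < 1" by (simp add: one_ereal_def)
    also have "1 \<le> fps_conv_radius (Abs_fps ?f)" by (rule R)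
    finally show "z \<in> eball 0 (fps_conv_radius (Abs_fps ?f))" by (simp add: in_eball_iff)
  qed
  then have "eval_fps (Abs_fps ?f) holomorphic_on ball 0 1"
    by (rule holomorphic_on_eval_fps)
  then show ?thesis
  proof (rule holomorphic_transform)
    fix z :: complex assume "z \<in> ball 0 1"
    then show "eval_fps (Abs_fps ?f) z = hyp2F1 (of_real a) (of_real b) (of_real c) z"
      using hyp2F1_of_real_sums[OF assms, of z] by (simp add: eval_fps_def sums_iff)
  qed
qed

abbreviation hypE :: "complex \<Rightarrow> complex" where "hypE \<equiv> hyp2F1 (1 / 4) (1 / 4) (1 / 2)"
abbreviation hypO :: "complex \<Rightarrow> complex" where "hypO \<equiv> hyp2F1 (3 / 4) (3 / 4) (3 / 2)"

lemma hypE_holomorphic: "hypE holomorphic_on ball 0 1"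
  using hyp2F1_holomorphic[of "1/4" "1/4" "1/2"] by simp

lemma hypO_holomorphic: "hypO holomorphic_on ball 0 1"
  using hyp2F1_holomorphic[of "3/4" "3/4" "3/2"] by simp

section \<open>A Beta-type integral and its expansion in powers of \<open>w\<close>\<close>

definition binom_coeff :: "nat \<Rightarrow> real" where
  "binom_coeff k = pochhammer (1 / 2) k / fact k"

lemma binom_coeff_nonneg: "binom_coeff k \<ge> 0"
  by (simp add: binom_coeff_def pochhammer_nonneg)

lemma inverse_csqrt_sums:
  fixes u :: complex
  assumes "norm u < 1"
  shows "(\<lambda>k. of_real (binom_coeff k) * u ^ k) sums (1 / csqrt (1 - u))"
proof -
  have nz: "1 - u \<noteq> 0" using assms by auto
  have "(\<lambda>k. ((- 1 / 2) gchoose k) * (- u) ^ k) sums (1 + - u) powr (- 1 / 2)"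
    by (rule gen_binomial_complex) (use assms in simp)
  moreover have "((- 1 / 2) gchoose k) * (- u) ^ k = of_real (binom_coeff k) * u ^ k" for k
  proof -
    have "((- 1 / 2 :: complex) gchoose k) = (- 1) ^ k * of_real (binom_coeff k)"
      by (simp add: gbinomial_pochhammer binom_coeff_def flip: pochhammer_of_real)
    moreover have "(- u) ^ k = (- 1) ^ k * u ^ k" by (rule power_minus)
    ultimately show ?thesis by (simp add: mult_ac flip: power_mult_distrib)
  qed
  moreover have "(1 + - u) powr (- 1 / 2) = 1 / csqrt (1 - u)"
  proof -
    have "(1 + - u) powr (- 1 / 2) = exp (- (Ln (1 - u) / 2))"
      using nz by (simp add: powr_def)
    then show ?thesis
      unfolding exp_minus csqrt_exp_Ln[OF nz] by (simp only: inverse_eq_divide)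
  qed
  ultimately show ?thesis by simp
qed

text \<open>The exponents are chosen so that the moments of \<open>sqrt y\<close> are
  \<open>Beta (k / 2 + 1 / 4) (1 / 2)\<close>: raising \<open>k\<close> by 2 raises the first
  argument by 1, which gives a rational recurrence within each parity class.\<close>

definition beta_weight :: "real \<Rightarrow> real" where
  "beta_weight y = y powr (- 3 / 4) * (1 - y) powr (- 1 / 2)"

definition beta_moment :: "nat \<Rightarrow> real" where
  "beta_moment k = Beta (real k / 2 + 1 / 4) (1 / 2)"

lemma beta_weight_measurable [measurable]: "beta_weight \<in> borel_measurable borel"
  unfolding beta_weight_def by measurable

lemma beta_weight_pos: "y \<in> {0<..<1} \<Longrightarrow> beta_weight y > 0"
  by (simp add: beta_weight_def)

lemma beta_moment_integral:
  shows "set_integrable lborel {0<..<1} (\<lambda>y. beta_weight y * sqrt y ^ k)"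
    and "(LBINT y:{0<..<1}. beta_weight y * sqrt y ^ k) = beta_moment k"
proof -
  let ?f = "\<lambda>y. y powr ((real k / 2 + 1 / 4) - 1) * (1 - y) powr (1 / 2 - 1)"
  have eq: "beta_weight y * sqrt y ^ k = ?f y" if "y \<in> {0<..<1}" for y
  proof -
    have "sqrt y ^ k = y powr (real k / 2)"
      using that by (simp add: powr_half_sqrt[symmetric] powr_realpow[symmetric] powr_powr)
    then show ?thesis
      by (simp add: beta_weight_def powr_add[symmetric] mult_ac)
  qed
  have "set_integrable lborel {0..1} ?f"
    by (rule integrable_Beta) auto
  then have i: "set_integrable lborel {0<..<1} ?f"
    by (rule set_integrable_subset) auto
  also have "?this \<longleftrightarrow> set_integrable lborel {0<..<1} (\<lambda>y. beta_weight y * sqrt y ^ k)"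
    by (rule set_integrable_cong) (auto simp: eq)
  finally show "set_integrable lborel {0<..<1} (\<lambda>y. beta_weight y * sqrt y ^ k)" .
  have "(LBINT y:{0<..<1}. beta_weight y * sqrt y ^ k) = (LBINT y:{0<..<1}. ?f y)"
    by (rule set_lebesgue_integral_cong) (auto simp: eq)
  also have "\<dots> = integral {0<..<1} ?f"
    using i by (rule set_borel_integral_eq_integral)
  also have "(?f has_integral beta_moment k) {0<..<1}"
    using has_integral_Beta_real[of "real k / 2 + 1 / 4" "1 / 2"]
    by (simp add: has_integral_Icc_iff_Ioo beta_moment_def)
  then have "integral {0<..<1} ?f = beta_moment k"
    by (rule integral_unique)
  finally show "(LBINT y:{0<..<1}. beta_weight y * sqrt y ^ k) = beta_moment k" .
qed

lemma beta_moment_le: "beta_moment k \<le> beta_moment 0"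
  unfolding beta_moment_integral(2)[symmetric]
proof (rule set_integral_mono)
  fix y :: real assume "y \<in> {0<..<1}"
  then show "beta_weight y * sqrt y ^ k \<le> beta_weight y * sqrt y ^ 0"
    using beta_weight_pos[of y] by (auto intro!: mult_left_mono power_le_one)
qed (rule beta_moment_integral)+

lemma beta_moment_nonneg: "beta_moment k \<ge> 0"
  unfolding beta_moment_def Beta_def by (auto intro!: Gamma_real_nonneg mult_nonneg_nonneg divide_nonneg_nonneg)

definition ellP_integrand :: "complex \<Rightarrow> real \<Rightarrow> complex" where
  "ellP_integrand w y = of_real (beta_weight y) / csqrt (1 - w * of_real (sqrt y))"

text \<open>For real \<open>w\<close> this turns out to be \<open>2 * sqrt 2\<close> times K at the
  modulus with \<open>k^2 = (1 + w) / 2\<close>; the integral extends it to the complex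
  disc.\<close>

definition ellP :: "complex \<Rightarrow> complex" where
  "ellP w = (LBINT y:{0<..<1}. ellP_integrand w y)"

text \<open>Termwise integration of the binomial series. The integrals of the absolute values are at
  most \<open>beta_moment 0\<close> times the terms of the binomial series at \<open>norm w\<close>,
  and the theorem on integrating a series yields integrability and the sum under the same
  premises.\<close>

lemma
  assumes w: "norm w < 1"
  shows set_integrable_ellP: "set_integrable lborel {0<..<1} (ellP_integrand w)"
    and ellP_sums: "(\<lambda>k. of_real (binom_coeff k * beta_moment k) * w ^ k) sums ellP w"
proof -
  define F where "F = (\<lambda>k y. indicat_real {0<..<1} y *\<^sub>R
    (of_real (binom_coeff k * (beta_weight y * sqrt y ^ k)) * w ^ k))"
  have int1: "integrable lborel (\<lambda>y. indicat_real {0<..<1} y * (beta_weight y * sqrt y ^ k))" for k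
    using beta_moment_integral(1)[of k] by (simp add: set_integrable_def)
  have F_alt: "F k y = of_real (indicat_real {0<..<1} y * (beta_weight y * sqrt y ^ k))
      * (of_real (binom_coeff k) * w ^ k)" for k y
    by (simp add: F_def scaleR_conv_of_real)
  have F_norm: "norm (F k y) = (indicat_real {0<..<1} y * (beta_weight y * sqrt y ^ k))
      * (binom_coeff k * norm w ^ k)" for k y
    unfolding F_alt norm_mult norm_of_real norm_power
    using beta_weight_pos[of y] binom_coeff_nonneg[of k] by (auto simp: indicator_def abs_mult)
  have u: "norm (w * of_real (sqrt y)) < 1" if "y \<in> {0<..<1}" for y
  proof -
    have "norm w * sqrt y \<le> norm w * 1"
      using that by (intro mult_left_mono) auto
    then show ?thesis using w that by (simp add: norm_mult)
  qed
  have F_sums: "(\<lambda>k. F k y) sums (indicat_real {0<..<1} y *\<^sub>R ellP_integrand w y)" for y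
  proof (cases "y \<in> {0<..<1}")
    case True
    have "(\<lambda>k. of_real (beta_weight y) * (of_real (binom_coeff k) * (w * of_real (sqrt y)) ^ k))
        sums (of_real (beta_weight y) * (1 / csqrt (1 - w * of_real (sqrt y))))"
      by (intro sums_mult inverse_csqrt_sums u True)
    then show ?thesis
      using True by (simp add: F_def ellP_integrand_def power_mult_distrib mult_ac)
  qed (simp add: F_def)
  have int: "integrable lborel (F k)" for k
    unfolding F_alt by (intro integrable_mult_left integrable_of_real int1)
  have intF: "integral\<^sup>L lborel (F k) = of_real (binom_coeff k * beta_moment k) * w ^ k" for k
  proof -
    have "integral\<^sup>L lborel (F k) = of_real (integral\<^sup>L lborel (\<lambda>y. indicat_real {0<..<1} y * (beta_weight y * sqrt y ^ k)))
        * (of_real (binom_coeff k) * w ^ k)"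
      unfolding F_alt by (simp only: integral_mult_left_zero integral_complex_of_real)
    also have "integral\<^sup>L lborel (\<lambda>y. indicat_real {0<..<1} y * (beta_weight y * sqrt y ^ k)) = beta_moment k"
      using beta_moment_integral(2)[of k] by (simp add: set_lebesgue_integral_def)
    finally show ?thesis by (simp add: mult_ac)
  qed
  have intn: "integral\<^sup>L lborel (\<lambda>y. norm (F k y)) = beta_moment k * (binom_coeff k * norm w ^ k)" for k
  proof -
    have "integral\<^sup>L lborel (\<lambda>y. norm (F k y)) =
        integral\<^sup>L lborel (\<lambda>y. indicat_real {0<..<1} y * (beta_weight y * sqrt y ^ k)) * (binom_coeff k * norm w ^ k)"
      unfolding F_norm by simp
    also have "integral\<^sup>L lborel (\<lambda>y. indicat_real {0<..<1} y * (beta_weight y * sqrt y ^ k)) = beta_moment k"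
      using beta_moment_integral(2)[of k] by (simp add: set_lebesgue_integral_def)
    finally show ?thesis .
  qed
  have sm: "summable (\<lambda>k. binom_coeff k * r ^ k)" if "0 \<le> r" "r < 1" for r :: real
  proof -
    have "summable (\<lambda>k. of_real (binom_coeff k) * (of_real r :: complex) ^ k)"
      using inverse_csqrt_sums[of "of_real r"] that by (simp add: sums_iff)
    then have "summable (\<lambda>k. of_real (binom_coeff k * r ^ k) :: complex)" by simp
    then show ?thesis by (simp only: summable_of_real_iff)
  qed
  have pointwise: "AE y in lborel. summable (\<lambda>k. norm (F k y))"
  proof (rule AE_I2)
    fix y :: real
    show "summable (\<lambda>k. norm (F k y))"
    proof (cases "y \<in> {0<..<1}")
      case True
      have "summable (\<lambda>k. beta_weight y * (binom_coeff k * (norm w * sqrt y) ^ k))"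
        by (intro summable_mult sm) (use u[OF True] True in \<open>auto simp: norm_mult\<close>)
      then show ?thesis
        using True by (simp add: F_norm power_mult_distrib mult_ac)
    qed (simp add: F_def)
  qed
  have total: "summable (\<lambda>k. integral\<^sup>L lborel (\<lambda>y. norm (F k y)))"
    unfolding intn
  proof (rule summable_comparison_test')
    show "summable (\<lambda>k. beta_moment 0 * (binom_coeff k * norm w ^ k))"
      by (intro summable_mult sm) (use w in auto)
    show "norm (beta_moment k * (binom_coeff k * norm w ^ k)) \<le> beta_moment 0 * (binom_coeff k * norm w ^ k)"
      if "k \<ge> 0" for k
      using beta_moment_le[of k] beta_moment_nonneg[of k] binom_coeff_nonneg[of k]
      by (auto simp: abs_mult intro!: mult_right_mono)
  qed
  have sumF: "(\<Sum>k. F k y) = indicat_real {0<..<1} y *\<^sub>R ellP_integrand w y" for y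
    using F_sums sums_unique by metis
  show "set_integrable lborel {0<..<1} (ellP_integrand w)"
    unfolding set_integrable_def
    using integrable_suminf[OF int pointwise total] by (simp add: sumF)
  show "(\<lambda>k. of_real (binom_coeff k * beta_moment k) * w ^ k) sums ellP w"
    using sums_integral[OF int pointwise total]
    by (simp add: sumF intF ellP_def set_lebesgue_integral_def)
qed

lemma beta_moment_Suc_Suc: "beta_moment (Suc (Suc k)) = beta_moment k * (2 * real k + 1) / (2 * real k + 3)"
proof -
  have "real k / 2 + 1 / 4 > 0" by (simp add: add_nonneg_pos)
  then have n: "real k / 2 + 1 / 4 \<notin> \<int>\<^sub>\<le>\<^sub>0"
    by (auto elim!: nonpos_Ints_cases)
  have "(real k / 2 + 1 / 4 + 1 / 2) * Beta (real k / 2 + 1 / 4 + 1) (1 / 2)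
      = (real k / 2 + 1 / 4) * Beta (real k / 2 + 1 / 4) (1 / 2 :: real)"
    by (rule Beta_plus1_left[OF n])
  moreover have "real (Suc (Suc k)) / 2 + 1 / 4 = real k / 2 + 1 / 4 + 1"
    by (simp add: field_simps)
  moreover have "real k / 2 + 1 / 4 + 1 / 2 = real k / 2 + 3 / 4" by simp
  ultimately have "(real k / 2 + 3 / 4) * beta_moment (Suc (Suc k)) = (real k / 2 + 1 / 4) * beta_moment k"
    unfolding beta_moment_def by (simp only:)
  then show ?thesis
    by (simp add: field_simps)
qed

lemma binom_coeff_Suc: "binom_coeff (Suc k) = binom_coeff k * (2 * real k + 1) / (2 * (real k + 1))"
proof -
  have "binom_coeff (Suc k) = binom_coeff k * ((1 / 2 + real k) / (1 + real k))"
    by (simp add: binom_coeff_def pochhammer_Suc)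
  also have "(1 / 2 + real k) / (1 + real k) = (2 * real k + 1) / (2 * (real k + 1))"
    by (simp add: field_simps)
  finally show ?thesis by simp
qed

text \<open>The factor \<open>2 * k + 3\<close> of the second binomial step cancels the denominator
  of the Beta recurrence. What remains is a hypergeometric ratio: parameters 1/4, 1/4; 1/2 for
  \<open>k = 2 * n\<close>, and 3/4, 3/4; 3/2 for \<open>k = 2 * n + 1\<close>.\<close>

lemma ellP_coeff_Suc_Suc:
  "binom_coeff (Suc (Suc k)) * beta_moment (Suc (Suc k)) =
    binom_coeff k * beta_moment k * (2 * real k + 1)\<^sup>2 / (4 * (real k + 1) * (real k + 2))"
proof -
  have *: "b * p / (2 * q) * s / (2 * t) * (m * p / s) = b * m * p\<^sup>2 / (4 * q * t)"
    if "s \<noteq> 0" for b p q s t m :: real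
    using that by (simp add: power2_eq_square mult_ac)
  have "2 * real (Suc k) + 1 = 2 * real k + 3" "real (Suc k) + 1 = real k + 2" "2 * real k + 3 \<noteq> 0"
    by (simp_all add: add_nonneg_eq_0_iff)
  then show ?thesis
    unfolding binom_coeff_Suc beta_moment_Suc_Suc by (simp only: * not_False_eq_True)
qed

lemma ellP_coeff_even:
  "binom_coeff (2 * n) * beta_moment (2 * n) =
    beta_moment 0 * (pochhammer (1 / 4) n * pochhammer (1 / 4) n / (pochhammer (1 / 2) n * fact n))"
proof (induction n)
  case 0
  show ?case by (simp add: binom_coeff_def)
next
  case (Suc n)
  have p: "pochhammer (1 / 2) n \<noteq> (0::real)"
    using pochhammer_pos[of "1/2::real" n] by simp
  have 1: "binom_coeff (2 * Suc n) * beta_moment (2 * Suc n) = binom_coeff (2 * n) * beta_moment (2 * n) * ((2 * real (2 * n) + 1)\<^sup>2 / (4 * (real (2 * n) + 1) * (real (2 * n) + 2)))"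
    using ellP_coeff_Suc_Suc[of "2 * n"] by simp
  have 2: "(2 * real (2 * n) + 1)\<^sup>2 / (4 * (real (2 * n) + 1) * (real (2 * n) + 2)) = (1 / 4 + real n)\<^sup>2 / ((1 / 2 + real n) * (1 + real n))"
    by (simp add: divide_simps) (simp add: algebra_simps power2_eq_square)
  have "binom_coeff (2 * Suc n) * beta_moment (2 * Suc n) = binom_coeff (2 * n) * beta_moment (2 * n) * ((1 / 4 + real n)\<^sup>2 / ((1 / 2 + real n) * (1 + real n)))"
    unfolding 1 2 ..
  also have "\<dots> = beta_moment 0 * (pochhammer (1 / 4) (Suc n) * pochhammer (1 / 4) (Suc n) /
      (pochhammer (1 / 2) (Suc n) * fact (Suc n)))"
  proof -
    have "B * (A * A / (C * D)) * (a\<^sup>2 / (c * d)) = B * ((A * a) * (A * a) / ((C * c) * (d * D)))"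
      for A B C D a c d :: real
      by (simp add: power2_eq_square mult_ac)
    then show ?thesis
      unfolding Suc.IH pochhammer_Suc fact_Suc by (simp only: add_ac of_nat_Suc of_nat_1)
  qed
  finally show ?case .
qed

lemma ellP_coeff_odd:
  "binom_coeff (2 * n + 1) * beta_moment (2 * n + 1) =
    beta_moment 1 / 2 * (pochhammer (3 / 4) n * pochhammer (3 / 4) n / (pochhammer (3 / 2) n * fact n))"
proof (induction n)
  case 0
  show ?case by (simp add: binom_coeff_def)
next
  case (Suc n)
  have p: "pochhammer (3 / 2) n \<noteq> (0::real)"
    using pochhammer_pos[of "3/2::real" n] by simp
  have 1: "binom_coeff (2 * Suc n + 1) * beta_moment (2 * Suc n + 1) = binom_coeff (2 * n + 1) * beta_moment (2 * n + 1) * ((2 * real (2 * n + 1) + 1)\<^sup>2 / (4 * (real (2 * n + 1) + 1) * (real (2 * n + 1) + 2)))"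
    using ellP_coeff_Suc_Suc[of "2 * n + 1"] by simp
  have 2: "(2 * real (2 * n + 1) + 1)\<^sup>2 / (4 * (real (2 * n + 1) + 1) * (real (2 * n + 1) + 2)) = (3 / 4 + real n)\<^sup>2 / ((3 / 2 + real n) * (1 + real n))"
    by (simp add: divide_simps) (simp add: algebra_simps power2_eq_square)
  have "binom_coeff (2 * Suc n + 1) * beta_moment (2 * Suc n + 1) = binom_coeff (2 * n + 1) * beta_moment (2 * n + 1) * ((3 / 4 + real n)\<^sup>2 / ((3 / 2 + real n) * (1 + real n)))"
    unfolding 1 2 ..
  also have "\<dots> = beta_moment 1 / 2 * (pochhammer (3 / 4) (Suc n) * pochhammer (3 / 4) (Suc n) /
      (pochhammer (3 / 2) (Suc n) * fact (Suc n)))"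
  proof -
    have "B * (A * A / (C * D)) * (a\<^sup>2 / (c * d)) = B * ((A * a) * (A * a) / ((C * c) * (d * D)))"
      for A B C D a c d :: real
      by (simp add: power2_eq_square mult_ac)
    then show ?thesis
      unfolding Suc.IH pochhammer_Suc fact_Suc by (simp only: add_ac of_nat_Suc of_nat_1)
  qed
  finally show ?case .
qed

lemma ellP_eq_hyp2F1:
  assumes "norm w < 1"
  shows "ellP w = of_real (beta_moment 0) * hypE (w\<^sup>2) + of_real (beta_moment 1 / 2) * w * hypO (w\<^sup>2)"
proof -
  have w2: "norm (w\<^sup>2) < 1"
    using assms by (simp add: norm_power power_less_one_iff)
  let ?a = "\<lambda>k. of_real (binom_coeff k * beta_moment k) * w ^ k"
  have "(\<lambda>n. of_real (beta_moment 0) *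
      (of_real (pochhammer (1/4) n * pochhammer (1/4) n / (pochhammer (1/2) n * fact n)) * (w\<^sup>2) ^ n))
      sums (of_real (beta_moment 0) * hypE (w\<^sup>2))"
    using sums_mult[OF hyp2F1_of_real_sums[of "1/4" "1/4" "1/2" "w\<^sup>2"]] w2 by simp
  also have "(\<lambda>n. of_real (beta_moment 0) *
      (of_real (pochhammer (1/4) n * pochhammer (1/4) n / (pochhammer (1/2) n * fact n)) * (w\<^sup>2) ^ n))
      = (\<lambda>n. ?a (2 * n))"
    unfolding ellP_coeff_even power_mult by (simp add: mult_ac)
  finally have E: "(\<lambda>n. ?a (2 * n)) sums (of_real (beta_moment 0) * hypE (w\<^sup>2))" .
  have "(\<lambda>n. of_real (beta_moment 1 / 2) * w *
      (of_real (pochhammer (3/4) n * pochhammer (3/4) n / (pochhammer (3/2) n * fact n)) * (w\<^sup>2) ^ n))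
      sums (of_real (beta_moment 1 / 2) * w * hypO (w\<^sup>2))"
    using sums_mult[OF hyp2F1_of_real_sums[of "3/4" "3/4" "3/2" "w\<^sup>2"],
        of "of_real (beta_moment 1 / 2) * w"] w2 by simp
  also have "(\<lambda>n. of_real (beta_moment 1 / 2) * w *
      (of_real (pochhammer (3/4) n * pochhammer (3/4) n / (pochhammer (3/2) n * fact n)) * (w\<^sup>2) ^ n))
      = (\<lambda>n. ?a (2 * n + 1))"
    unfolding ellP_coeff_odd power_add power_mult by (simp add: mult_ac)
  finally have O: "(\<lambda>n. ?a (2 * n + 1)) sums (of_real (beta_moment 1 / 2) * w * hypO (w\<^sup>2))" .
  have "(\<lambda>n. \<Sum>k=n * 2..<n * 2 + 2. ?a k) sums ellP w"
    by (rule sums_group[OF ellP_sums[OF assms]]) simp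
  also have "(\<lambda>n. \<Sum>k=n * 2..<n * 2 + 2. ?a k) = (\<lambda>n. ?a (2 * n) + ?a (2 * n + 1))"
    by (simp add: numeral_2_eq_2 mult_ac)
  finally show ?thesis
    using sums_unique2 sums_add[OF E O] by blast
qed

section \<open>The values of the integral lie in a sector\<close>

text \<open>\<open>|Im s| < Re s\<close> encodes |arg s| < pi/4; the principal root halves the
  angles of the right half-plane.\<close>

lemma csqrt_cone:
  assumes "Re u > 0"
  shows "\<bar>Im (csqrt u)\<bar> < Re (csqrt u)"
proof -
  have "Re u = (Re (csqrt u))\<^sup>2 - (Im (csqrt u))\<^sup>2"
    by (metis Re_power2 power2_csqrt)
  then have "\<bar>Im (csqrt u)\<bar>\<^sup>2 < (Re (csqrt u))\<^sup>2"
    unfolding power2_abs using assms by linarith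
  then show ?thesis
    by (rule power2_less_imp_less) (rule Re_csqrt)
qed

lemma inverse_csqrt_cone:
  assumes "Re u > 0"
  shows "\<bar>Im (1 / csqrt u)\<bar> < Re (1 / csqrt u)"
proof -
  define s where "s = csqrt u"
  have lt: "\<bar>Im s\<bar> < Re s"
    unfolding s_def by (rule csqrt_cone[OF assms])
  then have "(Re s)\<^sup>2 + (Im s)\<^sup>2 > 0" by (simp add: add_pos_nonneg)
  then show ?thesis
    using lt unfolding s_def[symmetric]
    by (simp add: Re_divide Im_divide divide_strict_right_mono abs_minus_commute)
qed

lemma Re_of_real_times: "Re (of_real r * z) = r * Re z"
  and Im_of_real_times: "Im (of_real r * z) = r * Im z"
  by simp_all

lemma ellP_integrand_cone:
  assumes "norm w < 1" "y \<in> {0<..<1}"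
  shows "\<bar>Im (ellP_integrand w y)\<bar> < Re (ellP_integrand w y)"
proof -
  have "norm (w * of_real (sqrt y)) < 1"
  proof -
    have "norm w * sqrt y \<le> norm w * 1"
      using assms by (intro mult_left_mono) auto
    then show ?thesis using assms by (simp add: norm_mult)
  qed
  then have "Re (w * of_real (sqrt y)) < 1"
    using complex_Re_le_cmod le_less_trans by blast
  then have "Re (1 - w * of_real (sqrt y)) > 0" by simp
  from inverse_csqrt_cone[OF this] have *: "\<bar>Im (1 / csqrt (1 - w * of_real (sqrt y)))\<bar> < Re (1 / csqrt (1 - w * of_real (sqrt y)))" .
  have eq: "ellP_integrand w y = of_real (beta_weight y) * (1 / csqrt (1 - w * of_real (sqrt y)))"
    by (simp add: ellP_integrand_def)
  have "beta_weight y > 0" using assms beta_weight_pos by auto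
  then show ?thesis
    using * by (simp only: eq Re_of_real_times Im_of_real_times abs_mult) simp
qed

lemma set_integral_pos_Ioo:
  fixes f :: "real \<Rightarrow> real"
  assumes "set_integrable lborel {a<..<b} f" "a < b" "\<And>y. y \<in> {a<..<b} \<Longrightarrow> f y > 0"
  shows "(LBINT y:{a<..<b}. f y) > 0"
proof -
  let ?g = "\<lambda>y. indicat_real {a<..<b} y *\<^sub>R f y"
  have g: "integrable lborel ?g" using assms(1) by (simp add: set_integrable_def)
  have nonneg: "?g y \<ge> 0" for y
    using assms(3)[of y] by (auto simp: indicator_def)
  have "integral\<^sup>L lborel ?g \<noteq> 0"
  proof
    assume "integral\<^sup>L lborel ?g = 0"
    then have "AE y in lborel. ?g y = 0"
      using integral_nonneg_eq_0_iff_AE[OF g] nonneg by simp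
    then have "AE y in lborel. y \<notin> {a<..<b}"
    proof eventually_elim
      case (elim y)
      then show ?case using assms(3)[of y] by (auto simp: indicator_def split: if_splits)
    qed
    then have "emeasure lborel {a<..<b} = 0"
      by (subst (asm) AE_iff_measurable[OF _ refl]) (auto simp: greaterThanLessThan_def greaterThan_def lessThan_def Int_def)
    then show False using assms(2) by simp
  qed
  moreover have "integral\<^sup>L lborel ?g \<ge> 0" using nonneg by simp
  ultimately show ?thesis
    unfolding set_lebesgue_integral_def by linarith
qed

text \<open>The sector is the intersection of the half-planes \<open>Re - Im > 0\<close> and
  \<open>Re + Im > 0\<close>, so integration preserves it, and strictly so because the interval has
  positive measure.\<close>

lemma ellP_cone:
  assumes "norm w < 1"
  shows "\<bar>Im (ellP w)\<bar> < Re (ellP w)"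
proof -
  let ?G = "ellP_integrand w"
  have i: "integrable lborel (\<lambda>y. indicat_real {0<..<1} y *\<^sub>R ?G y)"
    using set_integrable_ellP[OF assms] by (simp add: set_integrable_def)
  have iRe: "set_integrable lborel {0<..<1} (\<lambda>y. Re (?G y))"
    using integrable_Re[OF i] by (simp add: set_integrable_def)
  have iIm: "set_integrable lborel {0<..<1} (\<lambda>y. Im (?G y))"
    using integrable_Im[OF i] by (simp add: set_integrable_def)
  have Re: "Re (ellP w) = (LBINT y:{0<..<1}. Re (?G y))"
    using integral_Re[OF i] by (simp add: ellP_def set_lebesgue_integral_def)
  have Im: "Im (ellP w) = (LBINT y:{0<..<1}. Im (?G y))"
    using integral_Im[OF i] by (simp add: ellP_def set_lebesgue_integral_def)
  have c: "\<bar>Im (?G y)\<bar> < Re (?G y)" if "y \<in> {0<..<1}" for y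
    using ellP_integrand_cone[OF assms that] .
  have "(LBINT y:{0<..<1}. Re (?G y) - Im (?G y)) > 0"
  proof (rule set_integral_pos_Ioo)
    show "Re (?G y) - Im (?G y) > 0" if "y \<in> {0<..<1}" for y
      using c[OF that] by linarith
  qed (use set_integral_diff[OF iRe iIm] in auto)
  moreover have "(LBINT y:{0<..<1}. Re (?G y) + Im (?G y)) > 0"
  proof (rule set_integral_pos_Ioo)
    show "Re (?G y) + Im (?G y) > 0" if "y \<in> {0<..<1}" for y
      using c[OF that] by linarith
  qed (use set_integral_add[OF iRe iIm] in auto)
  ultimately show ?thesis
    unfolding Re Im set_integral_diff(2)[OF iRe iIm] set_integral_add(2)[OF iRe iIm] by linarith
qed

section \<open>Reduction to the elliptic integral for real \<open>w\<close>\<close>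

lemma powr_minus_three_quarters:
  assumes "s > (0::real)"
  shows "(s\<^sup>2) powr (- 3 / 4) = 1 / (s * sqrt s)"
proof -
  have "2 * (- 3 / 4) = - (1 + 1 / 2 :: real)" by simp
  moreover have "s\<^sup>2 = s powr 2" using assms by simp
  ultimately have "(s\<^sup>2) powr (- 3 / 4) = s powr (- (1 + 1 / 2))"
    by (metis powr_powr)
  also have "\<dots> = 1 / (s powr 1 * s powr (1 / 2))"
    by (simp only: powr_minus powr_add inverse_eq_divide)
  finally show ?thesis using assms by (simp add: powr_half_sqrt)
qed

lemma powr_minus_half:
  assumes "u > (0::real)"
  shows "u powr (- 1 / 2) = 1 / sqrt u"
  using powr_minus_divide[of u "1 / 2"] assms by (simp add: powr_half_sqrt)

text \<open>The Moebius map from \<open>r^2\<close> to \<open>s = r^2 / (r^2 + 2)\<close> is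
  determined by the branch points: \<open>s = 0, 1, -1, 1 / w\<close> correspond to
  \<open>r^2 = 0, \<infinity>, -1, - 1 / b^2\<close>, the last two being those of the integrand
  \<open>ell 1 (1 / b)\<close>.\<close>

lemma quartic_substitution:
  fixes r w b q s :: real
  assumes q: "q = r\<^sup>2 + 2" and s: "s = r\<^sup>2 / q" and b: "b > 0" "b\<^sup>2 = (1 - w) / 2"
  shows "s * (1 - s\<^sup>2) * (1 - w * s) =
    ((2 * r / q\<^sup>2) * (sqrt 2 * b))\<^sup>2 * ((r\<^sup>2 + 1\<^sup>2) * (r\<^sup>2 + (1 / b)\<^sup>2))"
proof -
  have "q > 0" by (simp add: q add_nonneg_pos)
  have "(1 - s\<^sup>2) * q\<^sup>2 = q\<^sup>2 - (s * q)\<^sup>2" by (simp add: algebra_simps power_mult_distrib)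
  also have "s * q = r\<^sup>2" using \<open>q > 0\<close> by (simp add: s)
  also have "q\<^sup>2 - (r\<^sup>2)\<^sup>2 = 4 * (r\<^sup>2 + 1)" unfolding q by (simp add: power2_sum)
  finally have 1: "1 - s\<^sup>2 = 4 * (r\<^sup>2 + 1) / q\<^sup>2" using \<open>q > 0\<close> by (simp add: eq_divide_eq)
  have "(1 - w * s) * q = q - w * (s * q)" by (simp add: algebra_simps)
  also have "s * q = r\<^sup>2" using \<open>q > 0\<close> by (simp add: s)
  also have "q - w * r\<^sup>2 = r\<^sup>2 * (1 - w) + 2" unfolding q by (simp add: algebra_simps)
  finally have 2: "1 - w * s = (r\<^sup>2 * (1 - w) + 2) / q" using \<open>q > 0\<close> by (simp add: eq_divide_eq)
  have "(sqrt 2 * b)\<^sup>2 * (r\<^sup>2 + (1 / b)\<^sup>2) = 2 * b\<^sup>2 * r\<^sup>2 + 2"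
    using b(1) by (simp add: power_mult_distrib power_divide distrib_left)
  then have 3: "r\<^sup>2 * (1 - w) + 2 = (sqrt 2 * b)\<^sup>2 * (r\<^sup>2 + (1 / b)\<^sup>2)"
    unfolding b(2) by simp
  have "s * (1 - s\<^sup>2) * (1 - w * s) = (r\<^sup>2 / q) * (4 * (r\<^sup>2 + 1) / q\<^sup>2) * ((r\<^sup>2 * (1 - w) + 2) / q)"
    unfolding 1 2 by (simp only: s)
  also have "\<dots> = (2 * r / q\<^sup>2)\<^sup>2 * ((r\<^sup>2 + 1\<^sup>2) * (r\<^sup>2 * (1 - w) + 2))"
  proof -
    have "(r\<^sup>2 / q) * (4 * A / q\<^sup>2) * (C / q) = (2 * r / q\<^sup>2)\<^sup>2 * (A * C)" for A C
      by (simp add: power2_eq_square mult_ac)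
    then show ?thesis by (simp only: power_one)
  qed
  also have "\<dots> = ((2 * r / q\<^sup>2) * (sqrt 2 * b))\<^sup>2 * ((r\<^sup>2 + 1\<^sup>2) * (r\<^sup>2 + (1 / b)\<^sup>2))"
    unfolding 3 power_mult_distrib[of "2 * r / q\<^sup>2"] by (simp only: mult_ac)
  finally show ?thesis .
qed

lemma quartic_substitution_cancel:
  assumes "r > 0" "q > (0::real)"
  shows "1 / (r\<^sup>2 / q * ((2 * r / q\<^sup>2) * c * d)) * (8 * r ^ 3 / q ^ 3) = 4 / c * (1 / d)"
proof -
  have "1 / (r\<^sup>2 / q * ((2 * r / q\<^sup>2) * c * d)) * (8 * r ^ 3 / q ^ 3) = (1 / (r\<^sup>2 / q * (2 * r / q\<^sup>2)) * (8 * r ^ 3 / q ^ 3)) * (1 / c * (1 / d))"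
    by simp
  also have "1 / (r\<^sup>2 / q * (2 * r / q\<^sup>2)) * (8 * r ^ 3 / q ^ 3) = 4"
    using assms by (simp add: power2_eq_square power3_eq_cube)
  finally show ?thesis by simp
qed
text \<open>The substitution is \<open>y = s^2\<close> with the Moebius map above. It produces
  \<open>ellint 1 (1 / b)\<close>, and homogeneity together with symmetry turns this into
  \<open>b * ellint 1 b\<close>, which cancels the \<open>b\<close> of the prefactor.\<close>

lemma ellP_of_real:
  assumes "\<bar>w\<bar> < 1"
  shows "ellP (of_real w) = of_real (2 * sqrt 2 * ellint 1 (sqrt ((1 - w) / 2)))"
proof -
  let ?f = "\<lambda>y. beta_weight y / sqrt (1 - w * sqrt y)"
  let ?g = "\<lambda>r::real. (r\<^sup>2 / (r\<^sup>2 + 2))\<^sup>2" and ?g' = "\<lambda>r::real. 8 * r ^ 3 / (r\<^sup>2 + 2) ^ 3"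
  define b where "b = sqrt ((1 - w) / 2)"
  have b: "b > 0" "b\<^sup>2 = (1 - w) / 2" using assms by (auto simp: b_def)
  have u: "1 - w * sqrt y > 0" if "y \<in> {0<..<1}" for y
  proof -
    have "w * sqrt y \<le> \<bar>w\<bar> * 1"
      using that by (intro mult_mono) auto
    then show ?thesis using assms by linarith
  qed
  have g01: "?g r \<in> {0<..<1}" if "r > 0" for r
  proof -
    have "r\<^sup>2 > 0" using that by simp
    moreover from this have "r\<^sup>2 + 2 > 0" by linarith
    ultimately have "0 < r\<^sup>2 / (r\<^sup>2 + 2)" "r\<^sup>2 / (r\<^sup>2 + 2) < 1" by auto
    then show ?thesis by (simp only: greaterThanLessThan_iff power_less_one_iff zero_less_power) simp
  qed
  have eq: "?f (?g r) * ?g' r = 4 / (sqrt 2 * b) * ell 1 (1 / b) r" if r: "r > 0" for r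
  proof -
    define q where "q = r\<^sup>2 + 2"
    define s where "s = r\<^sup>2 / q"
    define D where "D = sqrt ((r\<^sup>2 + 1\<^sup>2) * (r\<^sup>2 + (1 / b)\<^sup>2))"
    have q: "q > 0" by (simp add: q_def add_nonneg_pos)
    have s: "s > 0" using r q by (simp add: s_def)
    have "s\<^sup>2 \<in> {0<..<1}" using g01[OF r] by (simp only: s_def q_def)
    then have s2: "1 - s\<^sup>2 > 0" by simp
    have ss: "sqrt (s\<^sup>2) = s" using s by simp
    have "?f (?g r) = 1 / (s * sqrt s) * (1 / sqrt (1 - s\<^sup>2)) / sqrt (1 - w * s)"
      unfolding beta_weight_def q_def[symmetric] s_def[symmetric] ss
        powr_minus_three_quarters[OF s] powr_minus_half[OF s2] ..
    also have "\<dots> = 1 / (s * sqrt (s * (1 - s\<^sup>2) * (1 - w * s)))"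
      by (simp add: real_sqrt_mult)
    also have "sqrt (s * (1 - s\<^sup>2) * (1 - w * s)) = (2 * r / q\<^sup>2) * (sqrt 2 * b) * D"
    proof -
      have "(2 * r / q\<^sup>2) * (sqrt 2 * b) \<ge> 0" using r b by simp
      then show ?thesis
        unfolding quartic_substitution[OF q_def s_def b] D_def
        by (simp only: real_sqrt_mult[of "_\<^sup>2"] real_sqrt_abs abs_of_nonneg)
    qed
    finally have "?f (?g r) * ?g' r = 1 / (s * ((2 * r / q\<^sup>2) * (sqrt 2 * b) * D)) * (8 * r ^ 3 / q ^ 3)"
      by (simp only: q_def)
    also have "\<dots> = 4 / (sqrt 2 * b) * (1 / D)"
      unfolding s_def by (rule quartic_substitution_cancel[OF r q])
    finally show ?thesis by (simp only: ell_def D_def)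
  qed
  have E: "einterval 0 1 = {0<..<1::real}" by (auto simp: einterval_def one_ereal_def)
  have "(LBINT y=0..1. ?f y) = (LBINT r=0..\<infinity>. ?f (?g r) * ?g' r)"
  proof (rule interval_integral_substitution_nonneg(2))
    show "((ereal \<circ> ?g \<circ> real_of_ereal) \<longlongrightarrow> 0) (at_right 0)"
      by (auto simp: zero_ereal_def ereal_tendsto_simps intro!: tendsto_eq_intros)
    have "(?g \<longlongrightarrow> 1) at_top" by real_asymp
    then show "((ereal \<circ> ?g \<circ> real_of_ereal) \<longlongrightarrow> 1) (at_left \<infinity>)"
      unfolding one_ereal_def ereal_tendsto_simps .
    have "set_integrable lborel (einterval 0 \<infinity>) (\<lambda>r. 4 / (sqrt 2 * b) * ell 1 (1 / b) r)"
      by (intro set_integrable_mult_right set_integrable_ell) (use b in auto)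
    also have "?this \<longleftrightarrow> set_integrable lborel (einterval 0 \<infinity>) (\<lambda>r. ?f (?g r) * ?g' r)"
    proof (rule set_integrable_cong)
      fix t :: real assume "t \<in> einterval 0 \<infinity>"
      then have "t > 0" by (simp add: einterval_def)
      then show "4 / (sqrt 2 * b) * ell 1 (1 / b) t = ?f (?g t) * ?g' t" by (rule eq[symmetric])
    qed auto
    finally show "set_integrable lborel (einterval 0 \<infinity>) (\<lambda>r. ?f (?g r) * ?g' r)" .
  next
    fix r assume "0 < ereal r" "ereal r < \<infinity>"
    then have r: "r > 0" by simp
    have q: "r\<^sup>2 + 2 > 0" by (simp add: add_nonneg_pos)
    have "DERIV (\<lambda>r. r\<^sup>2 / (r\<^sup>2 + 2)) r :> 4 * r / (r\<^sup>2 + 2)\<^sup>2"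
      using q by (auto intro!: derivative_eq_intros simp: divide_simps) (simp add: algebra_simps power2_eq_square)
    from DERIV_power[OF this, of 2]
    have "DERIV ?g r :> 2 * (r\<^sup>2 / (r\<^sup>2 + 2)) * (4 * r / (r\<^sup>2 + 2)\<^sup>2)"
      by (simp add: mult_ac)
    moreover have "2 * (r\<^sup>2 / q) * (4 * r / q\<^sup>2) = 8 * r ^ 3 / q ^ 3" for q :: real
      by (simp add: power2_eq_square power3_eq_cube)
    ultimately show "DERIV ?g r :> ?g' r" by simp
    have y: "?g r \<in> {0<..<1}" by (rule g01[OF r])
    have "isCont ?f y" if "y \<in> {0<..<1}" for y
      unfolding beta_weight_def using that u[OF that] by (auto intro!: continuous_intros)
    then show "isCont ?f (?g r)" using y by blast
    show "isCont ?g' r" using q by (auto intro!: continuous_intros)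
    show "0 \<le> ?f (?g r)"
      using u[OF y] beta_weight_pos[OF y] by simp
  next
    show "0 \<le> ?g' r" if "0 \<le> ereal r" "ereal r \<le> \<infinity>" for r
      using that by simp
  qed auto
  also have "\<dots> = (LBINT r=0..\<infinity>. 4 / (sqrt 2 * b) * ell 1 (1 / b) r)"
  proof (rule interval_integral_cong)
    fix t :: real assume "t \<in> einterval (min 0 \<infinity>) (max 0 \<infinity>)"
    then have "t > 0" by (simp add: einterval_def)
    then show "?f (?g t) * ?g' t = 4 / (sqrt 2 * b) * ell 1 (1 / b) t" by (rule eq)
  qed
  also have "\<dots> = 4 / (sqrt 2 * b) * ellint 1 (1 / b)"
    by (simp add: ellint_def)
  also have "ellint 1 (1 / b) = b * ellint 1 b"
    using ellint_scale[of b 1 "1 / b"] b ellint_commute[of b 1] by (simp add: field_simps)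
  also have "4 / (sqrt 2 * b) * (b * ellint 1 b) = 2 * sqrt 2 * ellint 1 b"
    using b by (simp add: field_simps)
  finally have I: "(LBINT y:{0<..<1}. ?f y) = 2 * sqrt 2 * ellint 1 b"
    by (simp add: interval_lebesgue_integral_def E)
  have "ellP (of_real w) = (LBINT y:{0<..<1}. of_real (?f y))"
    unfolding ellP_def
  proof (rule set_lebesgue_integral_cong)
    show "\<forall>y. y \<in> {0<..<1} \<longrightarrow> ellP_integrand (of_real w) y = of_real (?f y)"
    proof (intro allI impI)
      fix y :: real assume y: "y \<in> {0<..<1}"
      have "1 - of_real w * of_real (sqrt y) = (of_real (1 - w * sqrt y) :: complex)" by simp
      then have "csqrt (1 - of_real w * of_real (sqrt y)) = of_real (sqrt (1 - w * sqrt y))"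
        using u[OF y] by (simp only: csqrt_of_real less_imp_le)
      then show "ellP_integrand (of_real w) y = of_real (?f y)"
        by (simp add: ellP_integrand_def)
    qed
  qed auto
  also have "\<dots> = of_real (LBINT y:{0<..<1}. ?f y)"
    by (rule set_integral_complex_of_real)
  finally show ?thesis unfolding I b_def .
qed

subsection \<open>Elliptic integrals of theta quotients\<close>

lemma ellint_theta34:
  assumes "x > 0"
  shows "ellint ((theta3r x)\<^sup>2) ((theta4r x)\<^sup>2) = pi / 2"
proof -
  let ?a = "\<lambda>n. (theta3r (2 ^ n * x))\<^sup>2" and ?b = "\<lambda>n. (theta4r (2 ^ n * x))\<^sup>2"
  have pos: "2 ^ n * x > 0" for n :: nat using assms by simp
  have a: "?a n > 0" for n using theta_shift_pos[OF pos, of 0 n] by simp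
  have b: "?b n > 0" for n using theta4r_nonzero[OF pos, of n] by simp
  have ba: "?b n \<le> ?a n" for n
    unfolding theta3r_square[OF pos] theta4r_square[OF pos]
    using zero_le_power2[of "theta2r (2 * (2 ^ n * x))"] by linarith
  have const: "ellint (?a n) (?b n) = ellint ((theta3r x)\<^sup>2) ((theta4r x)\<^sup>2)" for n
  proof (induction n)
    case (Suc n)
    have "ellint (?a (Suc n)) (?b (Suc n)) = ellint ((?a n + ?b n) / 2) (sqrt (?a n * ?b n))"
      unfolding theta34_mean[OF pos] by (simp add: mult_ac)
    also have "\<dots> = ellint (?a n) (?b n)"
      by (rule ellint_gauss[OF a b])
    finally show ?case using Suc.IH by simp
  qed simp
  note lim = filterlim_doubling[OF assms]
  have la: "?a \<longlonglongrightarrow> 1\<^sup>2"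
    by (intro tendsto_power filterlim_compose[OF theta3r_tendsto lim])
  have lb: "?b \<longlonglongrightarrow> 1\<^sup>2"
    by (intro tendsto_power filterlim_compose[OF theta4r_tendsto lim])
  have "(\<lambda>n. ellint (?a n) (?b n)) \<longlonglongrightarrow> pi / 2"
  proof (rule tendsto_sandwich)
    show "\<forall>\<^sub>F n in sequentially. pi / (2 * ?a n) \<le> ellint (?a n) (?b n)"
      using ellint_bounds(1)[OF b ba] by simp
    show "\<forall>\<^sub>F n in sequentially. ellint (?a n) (?b n) \<le> pi / (2 * ?b n)"
      using ellint_bounds(2)[OF b ba] by simp
    show "(\<lambda>n. pi / (2 * ?a n)) \<longlonglongrightarrow> pi / 2"
      using tendsto_divide[OF tendsto_const tendsto_mult[OF tendsto_const la], of 2 pi] by simp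
    show "(\<lambda>n. pi / (2 * ?b n)) \<longlonglongrightarrow> pi / 2"
      using tendsto_divide[OF tendsto_const tendsto_mult[OF tendsto_const lb], of 2 pi] by simp
  qed
  then show ?thesis
    unfolding const by (simp add: LIMSEQ_const_iff)
qed

text \<open>With theta_2 the mean runs backwards: the means at \<open>2 * x\<close> are half the
  squares at \<open>x\<close>. Invariance and homogeneity of degree -1 then give the factor
  2.\<close>

lemma ellint_theta32_double:
  assumes "x > 0"
  shows "ellint ((theta3r (2 * x))\<^sup>2) ((theta2r (2 * x))\<^sup>2) = 2 * ellint ((theta3r x)\<^sup>2) ((theta2r x)\<^sup>2)"
proof -
  let ?a = "(theta3r (2 * x))\<^sup>2" and ?b = "(theta2r (2 * x))\<^sup>2"
  have pos: "theta3r (2 * x) > 0" "theta2r (2 * x) > 0" "theta3r x > 0" "theta2r x > 0"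
    using assms by (simp_all add: theta_shift_pos)
  have 1: "(?a + ?b) / 2 = 1 / 2 * (theta3r x)\<^sup>2"
    using theta3r_square[OF assms] by simp
  have "sqrt (?a * ?b) = theta3r (2 * x) * theta2r (2 * x)"
    using pos by (simp add: real_sqrt_mult)
  then have 2: "sqrt (?a * ?b) = 1 / 2 * (theta2r x)\<^sup>2"
    unfolding theta2r_square[OF assms] by simp
  have "ellint ?a ?b = ellint ((?a + ?b) / 2) (sqrt (?a * ?b))"
    by (rule ellint_gauss[symmetric]) (use pos in auto)
  also have "\<dots> = ellint ((theta3r x)\<^sup>2) ((theta2r x)\<^sup>2) / (1 / 2)"
    unfolding 1 2 by (rule ellint_scale) (use pos in auto)
  finally show ?thesis by simp
qed

lemma arsinh_mono_real: "x \<le> y \<Longrightarrow> arsinh x \<le> arsinh (y :: real)"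
  by (simp only: not_less[symmetric] arsinh_less_iff_real not_False_eq_True)

text \<open>By the doubling formula \<open>H y / y\<close> is constant along
  \<open>2 ^ n * x\<close>, so it equals its limit. There theta_3 tends to 1, the square of theta_2
  decays like \<open>exp (- pi * y / 2)\<close>, and the integral grows like minus the logarithm of
  that square.\<close>

lemma ellint_theta32:
  assumes "x > 0"
  shows "ellint ((theta3r x)\<^sup>2) ((theta2r x)\<^sup>2) = pi / 2 * x"
proof -
  define H where "H = (\<lambda>y. ellint ((theta3r y)\<^sup>2) ((theta2r y)\<^sup>2))"
  have dbl: "H (2 ^ n * x) / (2 ^ n * x) = H x / x" for n
  proof (induction n)
    case (Suc n)
    have "H (2 * (2 ^ n * x)) = 2 * H (2 ^ n * x)"
      unfolding H_def by (rule ellint_theta32_double) (use assms in simp)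
    then show ?case using Suc.IH by (simp add: mult_ac)
  qed simp
  note lim = filterlim_doubling[OF assms]
  have a: "(theta3r y)\<^sup>2 \<ge> 1" if "y \<ge> 1" for y
    using theta3r_bounds(1)[OF that] by (simp add: one_le_power)
  have b: "(theta2r y)\<^sup>2 > 0" if "y \<ge> 1" for y
    using theta_shift_pos[of y "1/2"] that by simp
  have upper: "H y / y \<le> (arsinh (exp (pi * y / 2)) + 1) / y" if y: "y \<ge> 1" for y
  proof -
    have "H y \<le> arsinh (1 / (theta2r y)\<^sup>2) / (theta3r y)\<^sup>2 + 1"
      unfolding H_def by (rule ellint_le_arsinh) (use a[OF y] b[OF y] in auto)
    also have "arsinh (1 / (theta2r y)\<^sup>2) / (theta3r y)\<^sup>2 \<le> arsinh (1 / (theta2r y)\<^sup>2) / 1"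
    proof -
      have "arsinh (1 / (theta2r y)\<^sup>2) \<ge> 0"
        using arsinh_mono_real[of 0 "1 / (theta2r y)\<^sup>2"] by simp
      then show ?thesis using a[OF y] by (intro divide_left_mono) auto
    qed
    also have "1 / (theta2r y)\<^sup>2 \<le> exp (pi * y / 2)"
    proof -
      have "(exp (- pi * y / 4))\<^sup>2 \<le> (theta2r y)\<^sup>2"
        using theta2r_bounds(1)[OF y] by (intro power_mono) auto
      also have "(exp (- pi * y / 4))\<^sup>2 = 1 / exp (pi * y / 2)"
        unfolding exp_double[symmetric] by (simp add: exp_minus inverse_eq_divide)
      finally show ?thesis using b[OF y] by (simp add: field_simps)
    qed
    then have "arsinh (1 / (theta2r y)\<^sup>2) / 1 \<le> arsinh (exp (pi * y / 2))"
      by (simp add: arsinh_mono_real)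
    finally show ?thesis using y by (simp add: divide_right_mono)
  qed
  have "H x / x \<le> pi / 2"
  proof (rule LIMSEQ_le_const)
    have "((\<lambda>y::real. (arsinh (exp (pi * y / 2)) + 1) / y) \<longlongrightarrow> pi / 2) at_top"
      unfolding arsinh_real_def by real_asymp
    then show "(\<lambda>n. (arsinh (exp (pi * (2 ^ n * x) / 2)) + 1) / (2 ^ n * x)) \<longlonglongrightarrow> pi / 2"
      by (rule filterlim_compose[OF _ lim])
    have "\<forall>\<^sub>F n in sequentially. 2 ^ n * x \<ge> 1"
      using filterlim_at_top[THEN iffD1, OF lim] by blast
    then have "\<forall>\<^sub>F n in sequentially. H x / x \<le> (arsinh (exp (pi * (2 ^ n * x) / 2)) + 1) / (2 ^ n * x)"
    proof eventually_elim
      case (elim n)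
      show ?case using upper[OF elim] unfolding dbl .
    qed
    then show "\<exists>N. \<forall>n\<ge>N. H x / x \<le> (arsinh (exp (pi * (2 ^ n * x) / 2)) + 1) / (2 ^ n * x)"
      by (simp add: eventually_sequentially)
  qed
  \<comment> \<open>The lower bound integrates over (0, d) only. For fixed \<open>d\<close> the
    limit in \<open>y\<close> is taken first; letting \<open>d\<close> tend to 0 afterwards removes
    the lost factor.\<close>
  moreover have "pi / 2 / sqrt (d\<^sup>2 + 1) \<le> H x / x" if d: "d > 0" for d
  proof -
    \<comment> \<open>Chosen so that the upper bound for \<open>theta2r\<close> gives
      \<open>(theta2r y)^2 \<le> C / exp (pi * y / 2)\<close>.\<close>
    define C where "C = (theta2r 1)\<^sup>2 * exp (pi / 2)"
    have C: "C > 0" using b[of 1] by (simp add: C_def)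
    have lower: "arsinh (d / C * exp (pi * y / 2)) / y / sqrt (d\<^sup>2 + (theta3r y) ^ 4) \<le> H y / y"
      if y: "y \<ge> 1" for y
    proof -
      have "(theta2r y)\<^sup>2 \<le> (theta2r 1 * exp (- pi * (y - 1) / 4))\<^sup>2"
        using theta2r_bounds(2)[OF y] theta_shift_pos[of y "1/2"] y by (intro power_mono) auto
      also have "\<dots> = (theta2r 1)\<^sup>2 * exp (pi / 2 - pi * y / 2)"
        by (simp add: power_mult_distrib field_simps flip: exp_of_nat_mult)
      also have "\<dots> = C / exp (pi * y / 2)"
        by (simp add: C_def exp_diff)
      finally have "exp (pi * y / 2) / C \<le> 1 / (theta2r y)\<^sup>2"
        using b[OF y] C by (simp add: field_simps)
      then have "d * (exp (pi * y / 2) / C) \<le> d * (1 / (theta2r y)\<^sup>2)"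
        using d by (intro mult_left_mono) auto
      then have "arsinh (d / C * exp (pi * y / 2)) \<le> arsinh (d / (theta2r y)\<^sup>2)"
        by (simp add: arsinh_mono_real)
      then have "arsinh (d / C * exp (pi * y / 2)) / sqrt (d\<^sup>2 + ((theta3r y)\<^sup>2)\<^sup>2)
          \<le> arsinh (d / (theta2r y)\<^sup>2) / sqrt (d\<^sup>2 + ((theta3r y)\<^sup>2)\<^sup>2)"
        by (intro divide_right_mono) auto
      also have "\<dots> \<le> H y"
        unfolding H_def by (rule ellint_ge_arsinh) (use a[OF y] b[OF y] d in auto)
      finally have "arsinh (d / C * exp (pi * y / 2)) / sqrt (d\<^sup>2 + ((theta3r y)\<^sup>2)\<^sup>2) / y \<le> H y / y"
        using y by (intro divide_right_mono) auto
      then show ?thesis by (simp add: mult_ac)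
    qed
    show ?thesis
    proof (rule LIMSEQ_le_const2)
      have 1: "((\<lambda>y::real. arsinh (d / C * exp (pi * y / 2)) / y) \<longlongrightarrow> pi / 2) at_top"
        unfolding arsinh_real_def using d C by real_asymp
      have "((\<lambda>y. arsinh (d / C * exp (pi * y / 2)) / y / sqrt (d\<^sup>2 + (theta3r y) ^ 4))
          \<longlongrightarrow> pi / 2 / sqrt (d\<^sup>2 + 1 ^ 4)) at_top"
        using d by (intro tendsto_divide[OF 1] tendsto_intros theta3r_tendsto) (auto simp: add_nonneg_eq_0_iff)
      then show "(\<lambda>n. arsinh (d / C * exp (pi * (2 ^ n * x) / 2)) / (2 ^ n * x) / sqrt (d\<^sup>2 + (theta3r (2 ^ n * x)) ^ 4))
          \<longlonglongrightarrow> pi / 2 / sqrt (d\<^sup>2 + 1)"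
        unfolding power_one by (rule filterlim_compose[OF _ lim])
      have "\<forall>\<^sub>F n in sequentially. 2 ^ n * x \<ge> 1"
        using filterlim_at_top[THEN iffD1, OF lim] by blast
      then have "\<forall>\<^sub>F n in sequentially. arsinh (d / C * exp (pi * (2 ^ n * x) / 2)) / (2 ^ n * x) /
          sqrt (d\<^sup>2 + (theta3r (2 ^ n * x)) ^ 4) \<le> H x / x"
      proof eventually_elim
        case (elim n)
        show ?case using lower[OF elim] unfolding dbl .
      qed
      then show "\<exists>N. \<forall>n\<ge>N. arsinh (d / C * exp (pi * (2 ^ n * x) / 2)) / (2 ^ n * x) /
          sqrt (d\<^sup>2 + (theta3r (2 ^ n * x)) ^ 4) \<le> H x / x"
        by (simp add: eventually_sequentially)
    qed
  qed
  then have "pi / 2 / sqrt (0\<^sup>2 + 1) \<le> H x / x"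
  proof (intro tendsto_upperbound[where F = "at_right 0"])
    show "((\<lambda>d::real. pi / 2 / sqrt (d\<^sup>2 + 1)) \<longlongrightarrow> pi / 2 / sqrt (0\<^sup>2 + 1)) (at_right 0)"
      by (intro tendsto_intros) auto
    assume *: "\<And>d. 0 < d \<Longrightarrow> pi / 2 / sqrt (d\<^sup>2 + 1) \<le> H x / x"
    show "\<forall>\<^sub>F d in at_right 0. pi / 2 / sqrt (d\<^sup>2 + 1) \<le> H x / x"
      using * by (auto simp: eventually_at_right_field intro!: exI[of _ 1])
  qed auto
  ultimately have "H x / x = pi / 2" by simp
  then show ?thesis using assms by (simp add: H_def field_simps)
qed

subsection \<open>The Taylor expansion of \<open>\<sigma>\<^sub>3\<close>\<close>

text \<open>A nonzero point of \<open>S\<close> already supplies a disc of convergence, and the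
  isolation of zeros does the rest. Working with a mere accumulating set allows points of the form
  \<open>t * U(t)^2\<close> in the final uniqueness argument.\<close>

lemma power_series_zero_if_islimpt:
  fixes a :: "nat \<Rightarrow> complex"
  assumes lim: "0 islimpt S" and S: "\<And>s. s \<in> S \<Longrightarrow> (\<lambda>n. a n * s ^ n) sums 0"
  shows "a n = 0"
proof (rule ccontr)
  assume an: "a n \<noteq> 0"
  obtain s where s: "s \<in> S" "s \<noteq> 0"
    using lim islimpt_approachable[of 0 S] zero_less_one by blast
  \<comment> \<open>The series is multiplied by \<open>z\<close>: the result
    \<open>powser_0_nonzero\<close> asks for a function vanishing at the centre and a nonzero
    coefficient of positive index.\<close>
  define b where "b = (\<lambda>m. case m of 0 \<Rightarrow> 0 | Suc k \<Rightarrow> a k)"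
  define f where "f = (\<lambda>z. z * (\<Sum>n. a n * z ^ n))"
  have "(\<lambda>m. b m * (z - 0) ^ m) sums f z" if "norm (z - 0) < norm s" for z
  proof -
    have "summable (\<lambda>n. a n * z ^ n)"
      using powser_inside[OF sums_summable[OF S[OF s(1)]], of z] that by simp
    then have "(\<lambda>n. z * (a n * z ^ n)) sums f z"
      unfolding f_def by (intro sums_mult summable_sums)
    then have "(\<lambda>m. b (Suc m) * (z - 0) ^ Suc m) sums f z"
      by (simp add: b_def mult_ac)
    from sums_Suc[OF this] show ?thesis by (simp add: b_def)
  qed
  moreover have "f 0 = 0" "b (Suc n) \<noteq> 0" "0 < norm s"
    using an s by (simp_all add: f_def b_def)
  ultimately obtain r where r: "r > 0" "\<And>z. z \<in> cball 0 r - {0} \<Longrightarrow> f z \<noteq> 0"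
    using powser_0_nonzero[of "norm s" 0 b f "Suc n"] by blast
  obtain z where z: "z \<in> S" "z \<noteq> 0" "dist z 0 < r"
    using lim r(1) islimpt_approachable[of 0 S] by blast
  have "f z = 0" using S[OF z(1)] by (simp add: f_def sums_iff)
  with r(2)[of z] z show False by auto
qed

section \<open>Holomorphy and conjugation symmetry of \<open>theta3\<close> and
  \<open>sigma3\<close>\<close>

lemma theta3_summand_norm:
  "norm (exp (- of_real pi * of_int n ^ 2 * x) :: complex) = exp (- pi * (of_int n + 0)\<^sup>2 * Re x)"
  by simp

lemma theta3_has_sum:
  assumes "Re x > 0"
  shows "((\<lambda>n::int. exp (- of_real pi * of_int n ^ 2 * x)) has_sum theta3 x) UNIV"
proof -
  have "(\<lambda>n::int. norm (exp (- of_real pi * of_int n ^ 2 * x))) summable_on UNIV"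
    unfolding theta3_summand_norm by (rule theta_shift_summable[OF assms])
  then show ?thesis
    unfolding theta3_def by (rule has_sum_infsum[OF abs_summable_summable])
qed

lemma theta3_of_real:
  assumes "x > 0"
  shows "theta3 (of_real x) = of_real (theta3r x)"
proof -
  have "((\<lambda>n::int. of_real (exp (- pi * (of_int n + 0)\<^sup>2 * x)) :: complex) has_sum of_real (theta3r x)) UNIV"
    by (rule has_sum_of_real[OF theta_shift_has_sum[OF assms]])
  also have "(\<lambda>n::int. of_real (exp (- pi * (of_int n + 0)\<^sup>2 * x)) :: complex) =
      (\<lambda>n. exp (- of_real pi * of_int n ^ 2 * of_real x))"
    by (simp add: exp_of_real[symmetric])
  finally show ?thesis
    using theta3_has_sum[of "of_real x"] assms has_sum_unique by fastforce
qed

lemma theta3_cnj: "theta3 (cnj x) = cnj (theta3 x)"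
proof -
  have "cnj (theta3 x) = (\<Sum>\<^sub>\<infinity>n\<in>(UNIV :: int set). cnj (exp (- of_real pi * of_int n ^ 2 * x)))"
    unfolding theta3_def by (rule infsum_cnj[symmetric])
  then show ?thesis by (simp add: theta3_def exp_cnj)
qed

lemma theta3_holomorphic: "theta3 holomorphic_on {x. Re x > 0}"
proof -
  have "\<exists>r>0. theta3 holomorphic_on ball z r" if z: "Re z > 0" for z
  proof -
    \<comment> \<open>On the closed ball of this radius \<open>Re x\<close> is at least
      \<open>r\<close>, so the real theta series at \<open>r\<close> is a majorant.\<close>
    define r where "r = Re z / 2"
    have r: "r > 0" using z by (simp add: r_def)
    let ?f = "\<lambda>n x. exp (- of_real pi * of_int n ^ 2 * x) :: complex"
    have ulim: "uniform_limit (cball z r) (\<lambda>X x. \<Sum>n\<in>X. ?f n x) theta3 (finite_subsets_at_top UNIV)"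
      unfolding theta3_def
    proof (rule Weierstrass_m_test_general)
      show "(\<lambda>n::int. exp (- pi * (of_int n + 0)\<^sup>2 * r)) summable_on UNIV"
        by (rule theta_shift_summable[OF r])
      fix n :: int and x assume "x \<in> cball z r"
      then have "\<bar>Re (z - x)\<bar> \<le> r"
        using abs_Re_le_cmod[of "z - x"] by (simp add: dist_norm)
      then have "Re z - Re x \<le> r" by (simp add: abs_le_iff)
      then have "r \<le> Re x" by (simp add: r_def)
      then have "pi * (of_int n)\<^sup>2 * r \<le> pi * (of_int n)\<^sup>2 * Re x"
        by (intro mult_left_mono) auto
      then show "norm (?f n x) \<le> exp (- pi * (of_int n + 0)\<^sup>2 * r)"
        unfolding theta3_summand_norm by simp
    qed
    have "\<forall>\<^sub>F X in finite_subsets_at_top (UNIV :: int set).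
        continuous_on (cball z r) (\<lambda>x. \<Sum>n\<in>X. ?f n x) \<and> (\<lambda>x. \<Sum>n\<in>X. ?f n x) holomorphic_on ball z r"
      by (intro always_eventually allI conjI continuous_intros holomorphic_intros)
    from holomorphic_uniform_limit[OF this ulim] r show ?thesis by auto
  qed
  then show ?thesis
    by (intro analytic_imp_holomorphic) (auto simp: analytic_on_def)
qed

lemma Re_one_plus_pos: "norm (z :: complex) < 1 \<Longrightarrow> Re (1 + z) > 0"
  using abs_Re_le_cmod[of z] by simp

lemma one_plus_nonzero: "norm (z :: complex) < 1 \<Longrightarrow> 1 + z \<noteq> 0"
  using Re_one_plus_pos[of z] by (metis less_irrefl zero_complex.sel(1))

lemma Re_moebius_pos:
  assumes "norm (z :: complex) < 1"
  shows "Re ((1 - z) / (1 + z)) > 0"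
proof -
  have nz: "1 + z \<noteq> 0" by (rule one_plus_nonzero[OF assms])
  have "Re ((1 - z) / (1 + z)) = (1 - (norm z)\<^sup>2) / (norm (1 + z))\<^sup>2"
    unfolding Re_divide' cmod_power2[of z] by (simp add: algebra_simps power2_eq_square)
  moreover have "1 - (norm z)\<^sup>2 > 0" using assms by (simp add: power_less_one_iff)
  ultimately show ?thesis using nz by simp
qed

lemma sigma3_holomorphic: "sigma3 holomorphic_on ball 0 1"
proof -
  have 1: "(\<lambda>z. theta3 ((1 - z) / (1 + z))) holomorphic_on ball 0 1"
  proof (rule holomorphic_on_compose_gen[OF _ theta3_holomorphic, unfolded o_def])
    show "(\<lambda>z. (1 - z) / (1 + z)) holomorphic_on ball 0 1"
      by (intro holomorphic_intros) (simp add: one_plus_nonzero)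
    show "(\<lambda>z. (1 - z) / (1 + z)) ` ball 0 1 \<subseteq> {x. Re x > 0}"
      using Re_moebius_pos by auto
  qed
  have 2: "(\<lambda>z. csqrt (1 + z)) holomorphic_on ball 0 1"
  proof (intro holomorphic_intros)
    fix z :: complex assume "z \<in> ball 0 1"
    then have "Re (1 + z) > 0" using Re_one_plus_pos by auto
    then show "1 + z \<notin> \<real>\<^sub>\<le>\<^sub>0" by (auto elim!: nonpos_Reals_cases simp: complex_eq_iff)
  qed
  have 3: "csqrt (1 + z) \<noteq> 0" if "z \<in> ball 0 1" for z
    using one_plus_nonzero[of z] that by simp
  show ?thesis
    unfolding sigma3_def [abs_def]
    by (intro holomorphic_on_mult holomorphic_on_divide holomorphic_on_const 1 2 3)
qed

text \<open>This symmetry makes the Taylor coefficients real. The principal root commutes with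
  conjugation here because \<open>1 + z\<close> lies in the right half-plane.\<close>

lemma sigma3_cnj:
  assumes "norm z < 1"
  shows "sigma3 (cnj z) = cnj (sigma3 z)"
proof -
  have "csqrt (cnj (1 + z)) = cnj (csqrt (1 + z))"
  proof (rule csqrt_unique)
    show "(cnj (csqrt (1 + z)))\<^sup>2 = cnj (1 + z)"
      by (simp only: complex_cnj_power[symmetric] power2_csqrt)
    show "0 < Re (cnj (csqrt (1 + z))) \<or> Re (cnj (csqrt (1 + z))) = 0 \<and> 0 \<le> Im (cnj (csqrt (1 + z)))"
    proof -
      have "Re (csqrt (1 + z)) > 0"
        using csqrt_cone[OF Re_one_plus_pos[OF assms]] by linarith
      then show ?thesis unfolding cnj.simps by blast
    qed
  qed
  then show ?thesis
    unfolding sigma3_def using theta3_cnj[of "(1 - z) / (1 + z)"] by simp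
qed

section \<open>Values on the real axis, and the inversion formula of theta_3\<close>

lemma sigma3_of_real:
  assumes "x > 0"
  shows "sigma3 (of_real ((1 - x) / (1 + x))) = of_real (sqrt ((1 + x) / 2) * theta3r x)"
proof -
  let ?z = "(1 - x) / (1 + x)"
  have 1: "1 + ?z = 2 / (1 + x)" using assms by (simp add: field_simps)
  have 2: "(1 - ?z) / (1 + ?z) = x" using assms by (simp add: field_simps)
  have "csqrt (1 + of_real ?z) = csqrt (of_real (1 + ?z))" by simp
  also have "\<dots> = of_real (sqrt (2 / (1 + x)))"
    unfolding 1 using assms by (intro csqrt_of_real) simp
  finally have "1 / csqrt (1 + of_real ?z) = of_real (1 / sqrt (2 / (1 + x)))" by simp
  also have "1 / sqrt (2 / (1 + x)) = sqrt ((1 + x) / 2)"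
    by (simp add: real_sqrt_divide)
  finally have 3: "1 / csqrt (1 + of_real ?z) = of_real (sqrt ((1 + x) / 2))" .
  have "(1 - of_real ?z) / (1 + of_real ?z) = (of_real ((1 - ?z) / (1 + ?z)) :: complex)" by simp
  then have "theta3 ((1 - of_real ?z) / (1 + of_real ?z)) = of_real (theta3r x)"
    unfolding 2 using theta3_of_real[OF assms] by simp
  with 3 show ?thesis unfolding sigma3_def by simp
qed

text \<open>In terms of the elliptic modulus this is \<open>1 - 2 k'\<^sup>2 = k\<^sup>2 - k'\<^sup>2\<close>.\<close>

definition theta_modulus :: "real \<Rightarrow> real" where
  "theta_modulus x = 1 - 2 * (theta4r x / theta3r x) ^ 4"

lemma theta_modulus_abs_less:
  assumes "x > 0"
  shows "\<bar>theta_modulus x\<bar> < 1"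
    and "- theta_modulus x = 1 - 2 * (theta2r x / theta3r x) ^ 4"
proof -
  have pos: "theta3r x ^ 4 > 0" "theta2r x ^ 4 > 0" "theta4r x ^ 4 > 0"
    using theta_shift_pos[OF assms, of 0] theta_shift_pos[OF assms, of "1/2"] theta4r_nonzero[OF assms]
    by (auto simp: zero_less_power_eq)
  have sum: "(theta2r x / theta3r x) ^ 4 + (theta4r x / theta3r x) ^ 4 = 1"
    unfolding power_divide add_divide_distrib[symmetric] theta_jacobi[OF assms, symmetric]
    using pos by simp
  moreover have "(theta2r x / theta3r x) ^ 4 > 0" "(theta4r x / theta3r x) ^ 4 > 0"
    unfolding power_divide using pos by simp_all
  ultimately show "\<bar>theta_modulus x\<bar> < 1" unfolding theta_modulus_def abs_less_iff by linarith
  show "- theta_modulus x = 1 - 2 * (theta2r x / theta3r x) ^ 4"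
    using sum by (simp add: theta_modulus_def)
qed

text \<open>At \<open>w = theta_modulus x\<close> the number \<open>(1 - w) / 2\<close> is the
  square of k', and at \<open>- w\<close> it is the square of k; so the two values are K and K' up
  to the common factor \<open>2 * sqrt 2\<close>.\<close>

lemma ellP_theta_modulus:
  assumes "x > 0"
  shows "ellP (of_real (theta_modulus x)) = of_real (sqrt 2 * pi * (theta3r x)\<^sup>2)"
    and "ellP (of_real (- theta_modulus x)) = of_real (sqrt 2 * pi * x * (theta3r x)\<^sup>2)"
proof -
  have t3: "theta3r x > 0" by (rule theta_shift_pos[OF assms])
  have scale: "ellint 1 (c\<^sup>2 / (theta3r x)\<^sup>2) = (theta3r x)\<^sup>2 * ellint ((theta3r x)\<^sup>2) (c\<^sup>2)"
    if "c \<noteq> 0" for c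
    using ellint_scale[of "(theta3r x)\<^sup>2" 1 "c\<^sup>2 / (theta3r x)\<^sup>2"] t3 that by (simp add: field_simps)
  have sq: "sqrt ((1 - (1 - 2 * (c / theta3r x) ^ 4)) / 2) = c\<^sup>2 / (theta3r x)\<^sup>2" for c
  proof -
    have "(1 - (1 - 2 * (c / theta3r x) ^ 4)) / 2 = ((c / theta3r x)\<^sup>2)\<^sup>2" by simp
    then have "sqrt ((1 - (1 - 2 * (c / theta3r x) ^ 4)) / 2) = (c / theta3r x)\<^sup>2"
      by (simp only: real_sqrt_abs abs_power2)
    then show ?thesis by (simp only: power_divide)
  qed
  note less = theta_modulus_abs_less(1)[OF assms]
  have "sqrt ((1 - theta_modulus x) / 2) = (theta4r x)\<^sup>2 / (theta3r x)\<^sup>2"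
    unfolding theta_modulus_def by (rule sq)
  then show "ellP (of_real (theta_modulus x)) = of_real (sqrt 2 * pi * (theta3r x)\<^sup>2)"
    unfolding ellP_of_real[OF less]
    by (simp add: scale[OF theta4r_nonzero[OF assms]] ellint_theta34[OF assms])
  have "sqrt ((1 - (- theta_modulus x)) / 2) = (theta2r x)\<^sup>2 / (theta3r x)\<^sup>2"
    unfolding theta_modulus_abs_less(2)[OF assms] by (rule sq)
  moreover have "theta2r x \<noteq> 0" using theta_shift_pos[OF assms, of "1/2"] by simp
  moreover have "\<bar>- theta_modulus x\<bar> < 1" using less by simp
  ultimately show "ellP (of_real (- theta_modulus x)) = of_real (sqrt 2 * pi * x * (theta3r x)\<^sup>2)"
    using ellP_of_real[of "- theta_modulus x"]
    by (simp add: scale ellint_theta32[OF assms])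
qed

lemma ellP_strict_mono:
  assumes "- 1 < v" "v < w" "w < 1"
  shows "Re (ellP (of_real v)) < Re (ellP (of_real w))"
proof -
  have n: "norm (of_real v :: complex) < 1" "norm (of_real w :: complex) < 1"
    using assms by auto
  have i: "integrable lborel (\<lambda>y. indicat_real {0<..<1} y *\<^sub>R ellP_integrand z y)" if "norm z < 1" for z
    using set_integrable_ellP[OF that] by (simp add: set_integrable_def)
  have iRe: "set_integrable lborel {0<..<1} (\<lambda>y. Re (ellP_integrand z y))" if "norm z < 1" for z
    using integrable_Re[OF i[OF that]] by (simp add: set_integrable_def)
  have Re: "Re (ellP z) = (LBINT y:{0<..<1}. Re (ellP_integrand z y))" if "norm z < 1" for z
    using integral_Re[OF i[OF that]] by (simp add: ellP_def set_lebesgue_integral_def)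
  have "(LBINT y:{0<..<1}. Re (ellP_integrand (of_real w) y) - Re (ellP_integrand (of_real v) y)) > 0"
  proof (rule set_integral_pos_Ioo)
    show "set_integrable lborel {0<..<1} (\<lambda>y. Re (ellP_integrand (of_real w) y) - Re (ellP_integrand (of_real v) y))"
      by (rule set_integral_diff(1)[OF iRe[OF n(2)] iRe[OF n(1)]])
    fix y :: real assume y: "y \<in> {0<..<1}"
    have val: "Re (ellP_integrand (of_real u) y) = beta_weight y / sqrt (1 - u * sqrt y)"
      if "1 - u * sqrt y > 0" for u
    proof -
      have "1 - of_real u * of_real (sqrt y) = (of_real (1 - u * sqrt y) :: complex)" by simp
      then have "csqrt (1 - of_real u * of_real (sqrt y)) = of_real (sqrt (1 - u * sqrt y))"
        using that by (simp only: csqrt_of_real less_imp_le)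
      then show ?thesis by (simp add: ellP_integrand_def)
    qed
    have "v * sqrt y < w * sqrt y" using assms y by simp
    moreover have "w * sqrt y < 1"
    proof (cases "w > 0")
      case True
      then have "w * sqrt y < 1 * 1" using assms y by (intro mult_strict_mono) auto
      then show ?thesis by simp
    next
      case False
      then have "w * sqrt y \<le> 0" using y by (simp add: mult_nonpos_nonneg)
      then show ?thesis by simp
    qed
    ultimately show "Re (ellP_integrand (of_real w) y) - Re (ellP_integrand (of_real v) y) > 0"
      using beta_weight_pos[OF y] by (simp add: val divide_strict_left_mono)
  qed simp
  then show ?thesis
    unfolding Re[OF n(1)] Re[OF n(2)] set_integral_diff(2)[OF iRe[OF n(2)] iRe[OF n(1)]] by simp
qed

text \<open>This is K'/K as a function of \<open>w\<close>. It is injective on (-1, 1) and a left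
  inverse of \<open>theta_modulus\<close>, so facts about that function can be read off from
  monotonicity.\<close>

definition ellP_ratio :: "real \<Rightarrow> real" where
  "ellP_ratio w = Re (ellP (of_real (- w))) / Re (ellP (of_real w))"

lemma ellP_Re_pos: "norm w < 1 \<Longrightarrow> Re (ellP w) > 0"
  using ellP_cone[of w] by simp

lemma ellP_ratio_strict_antimono:
  assumes "- 1 < v" "v < w" "w < 1"
  shows "ellP_ratio w < ellP_ratio v"
  unfolding ellP_ratio_def
proof (rule frac_less)
  show "Re (ellP (of_real (- w))) < Re (ellP (of_real (- v)))"
    by (rule ellP_strict_mono) (use assms in auto)
  show "Re (ellP (of_real v)) \<le> Re (ellP (of_real w))"
    using ellP_strict_mono[OF assms] by simp
qed (use assms in \<open>auto intro!: ellP_Re_pos less_imp_le\<close>)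

lemma ellP_ratio_less_iff:
  assumes "\<bar>v\<bar> < 1" "\<bar>w\<bar> < 1"
  shows "ellP_ratio v < ellP_ratio w \<longleftrightarrow> w < v"
  using ellP_ratio_strict_antimono[of v w] ellP_ratio_strict_antimono[of w v] assms
  by (cases v w rule: linorder_cases) (auto simp: abs_less_iff)

lemma ellP_ratio_minus: "ellP_ratio (- w) = 1 / ellP_ratio w"
  by (simp add: ellP_ratio_def)

lemma ellP_ratio_0: "ellP_ratio 0 = 1"
  using ellP_Re_pos[of 0] by (simp add: ellP_ratio_def)

lemma ellP_ratio_theta_modulus:
  assumes "x > 0"
  shows "ellP_ratio (theta_modulus x) = x"
  unfolding ellP_ratio_def ellP_theta_modulus[OF assms]
  using theta_shift_pos[OF assms, of 0] by simp

text \<open>Both sides have ratio \<open>1 / x\<close>, since negating \<open>w\<close> exchanges K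
  and K', and the ratio is injective.\<close>

lemma theta_modulus_inverse:
  assumes "x > 0"
  shows "theta_modulus (1 / x) = - theta_modulus x"
proof -
  have "ellP_ratio (theta_modulus (1 / x)) = ellP_ratio (- theta_modulus x)"
    using assms by (simp add: ellP_ratio_minus ellP_ratio_theta_modulus)
  then show ?thesis
    using ellP_ratio_less_iff[of "theta_modulus (1 / x)" "- theta_modulus x"]
      ellP_ratio_less_iff[of "- theta_modulus x" "theta_modulus (1 / x)"]
      theta_modulus_abs_less(1)[of x] theta_modulus_abs_less(1)[of "1 / x"] assms
    by simp
qed

text \<open>One value of \<open>ellP\<close> is read in two ways: as a multiple of K at
  \<open>1 / x\<close> and as a multiple of K' at \<open>x\<close>.\<close>

lemma theta3r_inverse:
  assumes "x > 0"
  shows "theta3r (1 / x) = sqrt x * theta3r x"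
proof -
  have ix: "1 / x > 0" using assms by simp
  have "of_real (sqrt 2 * pi * (theta3r (1 / x))\<^sup>2) = (of_real (sqrt 2 * pi * x * (theta3r x)\<^sup>2) :: complex)"
    using ellP_theta_modulus(1)[OF ix] ellP_theta_modulus(2)[OF assms]
    unfolding theta_modulus_inverse[OF assms] by simp
  then have "sqrt 2 * pi * (theta3r (1 / x))\<^sup>2 = sqrt 2 * pi * x * (theta3r x)\<^sup>2"
    by (simp only: of_real_eq_iff)
  then have "(theta3r (1 / x))\<^sup>2 = (sqrt x * theta3r x)\<^sup>2"
    using assms by (simp add: power_mult_distrib)
  then show ?thesis
    using theta_shift_pos[OF ix, of 0] theta_shift_pos[OF assms, of 0] assms
    by (simp add: power2_eq_iff_nonneg less_imp_le)
qed

text \<open>Under \<open>z = (1 - x) / (1 + x)\<close> the sign change of \<open>z\<close> is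
  \<open>x \<mapsto> 1 / x\<close>, and the prefactor of \<open>sigma3\<close> absorbs the
  \<open>sqrt x\<close> of the inversion formula.\<close>

lemma sigma3_even_real:
  assumes "x > 0"
  shows "sigma3 (- of_real ((1 - x) / (1 + x))) = sigma3 (of_real ((1 - x) / (1 + x)))"
proof -
  have "1 - 1 / x = - (1 - x) / x" "1 + 1 / x = (1 + x) / x"
    using assms by (simp_all add: field_simps)
  then have "- ((1 - x) / (1 + x)) = (1 - 1 / x) / (1 + 1 / x)"
    using assms by (simp only: minus_divide_left) simp
  then have "sigma3 (- of_real ((1 - x) / (1 + x))) = sigma3 (of_real ((1 - 1 / x) / (1 + 1 / x)))"
    by (simp only: of_real_minus[symmetric])
  also have "\<dots> = of_real (sqrt ((1 + 1 / x) / 2) * theta3r (1 / x))"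
    by (rule sigma3_of_real) (use assms in simp)
  also have "sqrt ((1 + 1 / x) / 2) * theta3r (1 / x) = sqrt ((1 + 1 / x) / 2 * x) * theta3r x"
    unfolding theta3r_inverse[OF assms] by (simp only: real_sqrt_mult mult.assoc)
  also have "(1 + 1 / x) / 2 * x = (1 + x) / 2"
    using assms by (simp add: field_simps)
  finally show ?thesis by (simp only: sigma3_of_real[OF assms])
qed

lemma sigma3_even:
  assumes "norm z < 1"
  shows "sigma3 (- z) = sigma3 z"
proof -
  let ?f = "\<lambda>z. sigma3 (- z) - sigma3 z"
  have "(\<lambda>z. sigma3 (- z)) holomorphic_on ball 0 1"
    by (rule holomorphic_on_compose_gen[OF _ sigma3_holomorphic, unfolded o_def])
       (auto intro!: holomorphic_intros)
  then have hol: "?f holomorphic_on ball 0 1"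
    by (intro holomorphic_intros sigma3_holomorphic)
  let ?U = "of_real ` {0<..<1::real} :: complex set"
  have lim: "0 islimpt ?U"
  proof (unfold islimpt_approachable, intro allI impI)
    fix e :: real assume "e > 0"
    then show "\<exists>x\<in>?U. x \<noteq> 0 \<and> dist x 0 < e"
      by (intro bexI[of _ "of_real (min (e / 2) (1 / 2))"]) auto
  qed
  have "?f z = 0"
  proof (rule analytic_continuation[OF hol open_ball connected_ball _ _ lim])
    fix u assume "u \<in> ?U"
    then obtain y where y: "u = of_real y" "0 < y" "y < 1" by auto
    define x where "x = (1 - y) / (1 + y)"
    have x: "x > 0" "y = (1 - x) / (1 + x)" using y by (auto simp: x_def divide_simps)
    show "?f u = 0" unfolding y(1) x(2) sigma3_even_real[OF x(1)] by simp
  qed (use assms in auto)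
  then show ?thesis by simp
qed

section \<open>Existence and uniqueness of the Taylor coefficients\<close>

lemma Phi_pos: "Phi > 0"
  unfolding Phi_def by (intro divide_pos_pos mult_pos_pos zero_less_power Gamma_real_pos) auto

lemma theta3_1: "theta3 1 = of_real (theta3r 1)"
  using theta3_of_real[of 1] by simp

text \<open>Averaging the Taylor series with its conjugate makes the coefficients real; averaging
  with the series at \<open>- z\<close> and grouping in pairs removes the odd terms. Positivity of
  \<open>Phi\<close> and of theta_3 at 1 allows the normalisation.\<close>

lemma sigma3_taylor_exists:
  "\<exists>d::nat \<Rightarrow> real. \<forall>z::complex. norm z < 1 \<longrightarrow>
     (\<lambda>n. theta3 1 * (of_real (d n) / fact (2 * n) * of_real Phi ^ n * z ^ (2 * n))) sums sigma3 z"
proof -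
  define c where "c = (\<lambda>n. (deriv ^^ n) sigma3 0 / fact n)"
  have c: "(\<lambda>n. c n * z ^ n) sums sigma3 z" if "norm z < 1" for z
    using holomorphic_power_series[OF sigma3_holomorphic, of z] that by (simp add: c_def)
  have re: "(\<lambda>n. of_real (Re (c n)) * z ^ n) sums sigma3 z" if z: "norm z < 1" for z
  proof -
    have "(\<lambda>n. cnj (c n * cnj z ^ n)) sums cnj (sigma3 (cnj z))"
      using c[of "cnj z"] z by (simp only: sums_cnj complex_mod_cnj)
    then have "(\<lambda>n. cnj (c n) * z ^ n) sums sigma3 z"
      using sigma3_cnj[OF z] by simp
    from sums_divide[OF sums_add[OF c[OF z] this], of 2]
    have "(\<lambda>n. (c n * z ^ n + cnj (c n) * z ^ n) / 2) sums sigma3 z" by simp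
    moreover have "(c n * z ^ n + cnj (c n) * z ^ n) / 2 = of_real (Re (c n)) * z ^ n" for n
    proof -
      have "c n * z ^ n + cnj (c n) * z ^ n = (c n + cnj (c n)) * z ^ n" by (simp add: algebra_simps)
      then show ?thesis by (simp add: complex_add_cnj)
    qed
    ultimately show ?thesis by simp
  qed
  have ev: "(\<lambda>n. of_real (Re (c (2 * n))) * z ^ (2 * n)) sums sigma3 z" if z: "norm z < 1" for z
  proof -
    from sums_divide[OF sums_add[OF re[OF z] re[of "- z"]], of 2] z
    have "(\<lambda>n. (of_real (Re (c n)) * z ^ n + of_real (Re (c n)) * (- z) ^ n) / 2) sums sigma3 z"
      using sigma3_even[OF z] by simp
    from sums_group[OF this, of 2]
    have "(\<lambda>n. \<Sum>k=n * 2..<n * 2 + 2. (of_real (Re (c k)) * z ^ k + of_real (Re (c k)) * (- z) ^ k) / 2) sums sigma3 z"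
      by simp
    also have "(\<lambda>n. \<Sum>k=n * 2..<n * 2 + 2. (of_real (Re (c k)) * z ^ k + of_real (Re (c k)) * (- z) ^ k) / 2)
        = (\<lambda>n. of_real (Re (c (2 * n))) * z ^ (2 * n))"
    proof
      fix n :: nat
      have "{n * 2..<n * 2 + 2} = {2 * n, 2 * n + 1}" by auto
      then show "(\<Sum>k=n * 2..<n * 2 + 2. (of_real (Re (c k)) * z ^ k + of_real (Re (c k)) * (- z) ^ k) / 2)
          = of_real (Re (c (2 * n))) * z ^ (2 * n)"
        by simp
    qed
    finally show ?thesis .
  qed
  define d where "d = (\<lambda>n. Re (c (2 * n)) * fact (2 * n) / (theta3r 1 * Phi ^ n))"
  have "theta3 1 * (of_real (d n) / fact (2 * n) * of_real Phi ^ n * z ^ (2 * n)) = of_real (Re (c (2 * n))) * z ^ (2 * n)"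
    for n z
    using Phi_pos theta_shift_pos[of 1 0] by (simp add: d_def theta3_1)
  with ev show ?thesis by (intro exI[of _ d]) simp
qed

lemma theta3_taylor_sums:
  assumes "norm z < 1"
  shows "(\<lambda>n. theta3 1 * (of_real (theta3_taylor n) / fact (2 * n) * of_real Phi ^ n * z ^ (2 * n))) sums sigma3 z"
proof -
  let ?T = "\<lambda>d::nat \<Rightarrow> real. \<forall>z::complex. norm z < 1 \<longrightarrow>
     (\<lambda>n. theta3 1 * (of_real (d n) / fact (2 * n) * of_real Phi ^ n * z ^ (2 * n))) sums sigma3 z"
  obtain d where d: "?T d" using sigma3_taylor_exists by blast
  have "d' = d" if d': "?T d'" for d'
  proof
    fix n
    let ?a = "\<lambda>n. theta3 1 * (of_real (d' n - d n) / fact (2 * n) * of_real Phi ^ n)"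
    let ?S = "of_real ` {0<..<1::real} :: complex set"
    have lim: "0 islimpt ?S"
    proof (unfold islimpt_approachable, intro allI impI)
      fix e :: real assume "e > 0"
      then show "\<exists>x\<in>?S. x \<noteq> 0 \<and> dist x 0 < e"
        by (intro bexI[of _ "of_real (min (e / 2) (1 / 2))"]) auto
    qed
    have "?a n = 0"
    proof (rule power_series_zero_if_islimpt[OF lim])
      fix s assume "s \<in> ?S"
      then obtain r where r: "s = of_real r" "0 < r" "r < 1" by auto
      \<comment> \<open>With \<open>z^2 = s\<close> the even series in \<open>z\<close> becomes an
        ordinary power series in \<open>s\<close>, as the uniqueness lemma requires.\<close>
      define z where "z = complex_of_real (sqrt r)"
      have z: "norm z < 1" "z\<^sup>2 = s" using r by (auto simp: z_def simp flip: of_real_power)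
      have "(\<lambda>n. theta3 1 * (of_real (d' n) / fact (2 * n) * of_real Phi ^ n * z ^ (2 * n)) -
          theta3 1 * (of_real (d n) / fact (2 * n) * of_real Phi ^ n * z ^ (2 * n))) sums (sigma3 z - sigma3 z)"
        by (rule sums_diff) (use d d' z in auto)
      then show "(\<lambda>n. ?a n * s ^ n) sums 0"
        unfolding power_mult z(2) by (simp add: algebra_simps diff_divide_distrib)
    qed
    then show "d' n = d n"
      using Phi_pos theta_shift_pos[of 1 0] by (simp add: theta3_1 flip: of_real_diff)
  qed
  then have "theta3_taylor = d"
    unfolding theta3_taylor_def using d by (intro the_equality)
  then show ?thesis using d assms by simp
qed

subsection \<open>The generating function\<close>

definition uniformizer :: "complex \<Rightarrow> complex" where
  "uniformizer w = (ellP w - ellP (- w)) / (ellP w + ellP (- w))"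

lemma beta_moment_pos: "beta_moment 0 > 0" "beta_moment 1 > 0"
  unfolding beta_moment_def Beta_def by (auto intro!: divide_pos_pos mult_pos_pos Gamma_real_pos)

lemma ellP_sum_diff:
  assumes "norm w < 1"
  shows "ellP w + ellP (- w) = of_real (2 * beta_moment 0) * hypE (w\<^sup>2)"
    and "ellP w - ellP (- w) = of_real (beta_moment 1) * w * hypO (w\<^sup>2)"
  using ellP_eq_hyp2F1[of w] ellP_eq_hyp2F1[of "- w"] assms by simp_all

text \<open>The even part is a positive multiple of a sum of two numbers in the right half-plane.
  This keeps the denominator of \<open>U\<close> away from 0 and the argument of the root off the
  branch cut.\<close>

lemma Re_hypE_pos:
  assumes "norm w < 1"
  shows "Re (hypE (w\<^sup>2)) > 0"
proof -
  have "Re (ellP w + ellP (- w)) > 0"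
    using ellP_Re_pos[of w] ellP_Re_pos[of "- w"] assms by simp
  then have "2 * beta_moment 0 * Re (hypE (w\<^sup>2)) > 0"
    unfolding ellP_sum_diff(1)[OF assms] Re_of_real_times .
  then show ?thesis
    using beta_moment_pos by (simp add: zero_less_mult_iff)
qed

lemma hypE_nonzero: "norm w < 1 \<Longrightarrow> hypE (w\<^sup>2) \<noteq> 0"
  using Re_hypE_pos[of w] by force

lemma uniformizer_eq:
  assumes "norm w < 1"
  shows "uniformizer w = of_real (beta_moment 1 / (2 * beta_moment 0)) * w * (hypO (w\<^sup>2) / hypE (w\<^sup>2))"
  unfolding uniformizer_def ellP_sum_diff[OF assms] by simp

text \<open>Both \<^term>\<open>ellP w\<close> and \<^term>\<open>ellP (- w)\<close> lie in the open sector \<open>|arg| < \<pi> / 4\<close>,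
  so they make an acute angle.\<close>

lemma uniformizer_norm_less:
  assumes "norm w < 1"
  shows "norm (uniformizer w) < 1"
proof -
  let ?p = "ellP w" and ?q = "ellP (- w)"
  have p: "\<bar>Im ?p\<bar> < Re ?p" and q: "\<bar>Im ?q\<bar> < Re ?q"
    using ellP_cone[of w] ellP_cone[of "- w"] assms by simp_all
  have "\<bar>Im ?p\<bar> * \<bar>Im ?q\<bar> < Re ?p * Re ?q"
    using p q by (intro mult_strict_mono) auto
  then have "Re ?p * Re ?q + Im ?p * Im ?q > 0"
    using abs_ge_minus_self[of "Im ?p * Im ?q"] unfolding abs_mult by linarith
  then have "(norm (?p - ?q))\<^sup>2 < (norm (?p + ?q))\<^sup>2"
    unfolding cmod_power2 by (simp add: power2_eq_square algebra_simps)
  then have "norm (?p - ?q) < norm (?p + ?q)"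
    by (rule power2_less_imp_less) simp
  then show ?thesis
    unfolding uniformizer_def norm_divide by (subst divide_less_eq_1_pos) (auto intro: le_less_trans[OF norm_ge_zero])
qed

lemma w_square_ball: "norm (w :: complex) < 1 \<Longrightarrow> w\<^sup>2 \<in> ball 0 1"
  by (simp add: norm_power power_less_one_iff)

lemma hyp_square_holomorphic:
  "(\<lambda>w. hypE (w\<^sup>2)) holomorphic_on ball 0 1" "(\<lambda>w. hypO (w\<^sup>2)) holomorphic_on ball 0 1"
  using w_square_ball
  by (auto intro!: holomorphic_on_compose_gen[OF _ hypE_holomorphic, unfolded o_def]
      holomorphic_on_compose_gen[OF _ hypO_holomorphic, unfolded o_def] holomorphic_intros)

lemma uniformizer_holomorphic: "uniformizer holomorphic_on ball 0 1"
proof -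
  have "(\<lambda>w. of_real (beta_moment 1 / (2 * beta_moment 0)) * w * (hypO (w\<^sup>2) / hypE (w\<^sup>2))) holomorphic_on ball 0 1"
    by (intro holomorphic_on_mult holomorphic_on_divide holomorphic_on_const holomorphic_on_ident hyp_square_holomorphic)
       (simp add: hypE_nonzero)
  then show ?thesis
    by (rule holomorphic_transform) (simp add: uniformizer_eq)
qed

lemma uniformizer_theta_modulus:
  assumes "x > 0"
  shows "uniformizer (of_real (theta_modulus x)) = of_real ((1 - x) / (1 + x))"
proof -
  let ?c = "sqrt 2 * pi * (theta3r x)\<^sup>2"
  have c: "?c \<noteq> 0" using theta_shift_pos[OF assms, of 0] by simp
  have m: "ellP (- of_real (theta_modulus x)) = of_real (x * ?c)"
    using ellP_theta_modulus(2)[OF assms] by (simp add: mult_ac)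
  have "uniformizer (of_real (theta_modulus x)) = of_real ((?c - x * ?c) / (?c + x * ?c))"
    unfolding uniformizer_def ellP_theta_modulus(1)[OF assms] m by simp
  also have "(?c - x * ?c) / (?c + x * ?c) = (?c * (1 - x)) / (?c * (1 + x))"
    by (simp add: algebra_simps)
  also have "\<dots> = (1 - x) / (1 + x)"
    by (rule mult_divide_mult_cancel_left[OF c])
  finally show ?thesis .
qed

lemma hypE_theta_modulus:
  assumes "x > 0"
  shows "hypE ((of_real (theta_modulus x))\<^sup>2) = of_real (sqrt 2 * pi * (theta3r x)\<^sup>2 * (1 + x) / (2 * beta_moment 0))"
proof -
  let ?c = "sqrt 2 * pi * (theta3r x)\<^sup>2"
  have n: "norm (of_real (theta_modulus x) :: complex) < 1"
    using theta_modulus_abs_less(1)[OF assms] by simp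
  have m: "ellP (- of_real (theta_modulus x)) = of_real (x * ?c)"
    using ellP_theta_modulus(2)[OF assms] by (simp add: mult_ac)
  have "of_real (2 * beta_moment 0) * hypE ((of_real (theta_modulus x))\<^sup>2) = of_real (?c + x * ?c)"
    using ellP_sum_diff(1)[OF n] unfolding ellP_theta_modulus(1)[OF assms] m by simp
  then have "hypE ((of_real (theta_modulus x))\<^sup>2) = of_real (?c + x * ?c) / of_real (2 * beta_moment 0)"
    using beta_moment_pos by (simp add: field_simps)
  also have "\<dots> = of_real (?c * (1 + x) / (2 * beta_moment 0))"
    by (simp add: algebra_simps)
  finally show ?thesis .
qed

lemma theta_modulus_1: "theta_modulus 1 = 0"
  using theta_modulus_inverse[of 1] by simp

lemma hyp2F1_at_0: "hyp2F1 a b c 0 = 1"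
  by (simp add: hyp2F1_eq_eval_fps eval_fps_at_0)

text \<open>At the fixed point \<open>x = 1\<close> of the inversion the modulus is 0 and the
  hypergeometric series is 1. This identifies the constant in front of the root in the next lemma as
  \<open>theta3 1\<close>.\<close>

lemma theta3r_1_square: "sqrt 2 * pi * (theta3r 1)\<^sup>2 = beta_moment 0"
proof -
  have "of_real (sqrt 2 * pi * (theta3r 1)\<^sup>2 * (1 + 1) / (2 * beta_moment 0)) = (1 :: complex)"
    using hypE_theta_modulus[of 1] by (simp add: theta_modulus_1 hyp2F1_at_0)
  then have "sqrt 2 * pi * (theta3r 1)\<^sup>2 * (1 + 1) / (2 * beta_moment 0) = 1"
    by (simp only: of_real_eq_1_iff)
  then show ?thesis using beta_moment_pos by (simp add: field_simps)
qed

lemma sigma3_uniformizer_real: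
  assumes "x > 0"
  shows "sigma3 (uniformizer (of_real (theta_modulus x))) =
    theta3 1 * csqrt (hypE ((of_real (theta_modulus x))\<^sup>2))"
proof -
  have t: "theta3r x > 0" "theta3r 1 > 0"
    using assms by (auto intro: theta_shift_pos)
  have "hypE ((of_real (theta_modulus x))\<^sup>2) = of_real ((theta3r x / theta3r 1)\<^sup>2 * ((1 + x) / 2))"
    unfolding hypE_theta_modulus[OF assms] theta3r_1_square[symmetric]
    by (simp add: power_divide)
  then have "csqrt (hypE ((of_real (theta_modulus x))\<^sup>2)) = of_real (sqrt ((theta3r x / theta3r 1)\<^sup>2 * ((1 + x) / 2)))"
    using assms by (simp only: csqrt_of_real) (simp add: csqrt_of_real)
  also have "sqrt ((theta3r x / theta3r 1)\<^sup>2 * ((1 + x) / 2)) = theta3r x / theta3r 1 * sqrt ((1 + x) / 2)"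
    unfolding real_sqrt_mult[of "_\<^sup>2"] using t by simp
  finally show ?thesis
    unfolding uniformizer_theta_modulus[OF assms] sigma3_of_real[OF assms] theta3_1
    using t by simp
qed

text \<open>Monotonicity of the ratio locates the modulus: for \<open>x\<close> strictly between 1
  and \<open>ellP_ratio (- d)\<close> it lies strictly between \<open>- d\<close> and 0.\<close>

lemma theta_modulus_islimpt:
  "0 islimpt ((\<lambda>x. of_real (theta_modulus x)) ` {0<..} :: complex set)"
proof (unfold islimpt_approachable, intro allI impI)
  fix e :: real assume e: "e > 0"
  define d where "d = min e (1 / 2)"
  have d: "0 < d" "d < 1" "d \<le> e" using e by (auto simp: d_def)
  have "1 < ellP_ratio (- d)"
    using ellP_ratio_strict_antimono[of "- d" 0] d by (simp add: ellP_ratio_0)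
  then obtain x where x: "1 < x" "x < ellP_ratio (- d)"
    using dense by blast
  then have x0: "x > 0" by simp
  note abs = theta_modulus_abs_less(1)[OF x0]
  have "ellP_ratio (theta_modulus x) < ellP_ratio (- d)"
    using x ellP_ratio_theta_modulus[OF x0] by simp
  then have "- d < theta_modulus x"
    using ellP_ratio_less_iff[of "theta_modulus x" "- d"] abs d by simp
  moreover have "ellP_ratio 0 < ellP_ratio (theta_modulus x)"
    using x ellP_ratio_theta_modulus[OF x0] by (simp add: ellP_ratio_0)
  then have "theta_modulus x < 0"
    using ellP_ratio_less_iff[of 0 "theta_modulus x"] abs by simp
  ultimately show "\<exists>w\<in>(\<lambda>x. of_real (theta_modulus x)) ` {0<..}. w \<noteq> 0 \<and> dist w (0::complex) < e"
    using x0 d by (intro bexI[of _ "of_real (theta_modulus x)"]) auto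
qed

lemma sigma3_uniformizer:
  assumes "norm w < 1"
  shows "sigma3 (uniformizer w) = theta3 1 * csqrt (hypE (w\<^sup>2))"
proof -
  let ?f = "\<lambda>w. sigma3 (uniformizer w) - theta3 1 * csqrt (hypE (w\<^sup>2))"
  have "(\<lambda>w. sigma3 (uniformizer w)) holomorphic_on ball 0 1"
    using uniformizer_norm_less
    by (intro holomorphic_on_compose_gen[OF uniformizer_holomorphic sigma3_holomorphic, unfolded o_def]) auto
  moreover have "(\<lambda>w. csqrt (hypE (w\<^sup>2))) holomorphic_on ball 0 1"
  proof (intro holomorphic_on_csqrt' hyp_square_holomorphic)
    fix w :: complex assume "w \<in> ball 0 1"
    then have "Re (hypE (w\<^sup>2)) > 0" using Re_hypE_pos by simp
    then show "hypE (w\<^sup>2) \<notin> \<real>\<^sub>\<le>\<^sub>0" by (auto elim!: nonpos_Reals_cases)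
  qed
  ultimately have hol: "?f holomorphic_on ball 0 1"
    by (intro holomorphic_on_diff holomorphic_on_mult holomorphic_on_const)
  have "?f w = 0"
  proof (rule analytic_continuation[OF hol open_ball connected_ball _ _ theta_modulus_islimpt])
    show "(\<lambda>x. of_real (theta_modulus x)) ` {0<..} \<subseteq> ball (0::complex) 1"
      using theta_modulus_abs_less(1) by auto
    show "?f u = 0" if "u \<in> (\<lambda>x. of_real (theta_modulus x)) ` {0<..}" for u
      using that sigma3_uniformizer_real by auto
  qed (use assms in auto)
  then show ?thesis by simp
qed

section \<open>The constant \<open>Phi\<close>\<close>

lemma Gamma_quarter_product: "Gamma (1 / 4) * Gamma (3 / 4) = sqrt 2 * (pi :: real)"
proof -
  have "of_real (Gamma (1 / 4) * Gamma (3 / 4)) = Gamma (of_real (1 / 4)) * (Gamma (of_real (3 / 4)) :: complex)"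
    by (simp only: Gamma_complex_of_real of_real_mult)
  also have "of_real (3 / 4) = 1 - (of_real (1 / 4) :: complex)" by simp
  also have "Gamma (of_real (1 / 4)) * Gamma (1 - of_real (1 / 4) :: complex) =
      of_real pi / sin (of_real pi * of_real (1 / 4))"
    by (rule Gamma_reflection_complex)
  also have "of_real pi * of_real (1 / 4) = (of_real (pi / 4) :: complex)" by simp
  also have "of_real pi / sin (of_real (pi / 4)) = (of_real (pi / sin (pi / 4)) :: complex)"
    unfolding sin_of_real by (rule of_real_divide[symmetric])
  finally have "of_real (Gamma (1 / 4) * Gamma (3 / 4)) = (of_real (pi / sin (pi / 4)) :: complex)" .
  then have "Gamma (1 / 4) * Gamma (3 / 4) = pi / sin (pi / 4)"
    by (simp only: of_real_eq_iff)
  also have "\<dots> = sqrt 2 * pi"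
    by (simp add: sin_45 field_simps)
  finally show ?thesis .
qed

text \<open>By reflection the coefficient \<open>beta_moment 1 / (2 * beta_moment 0)\<close> of
  \<open>w\<close> in the uniformizer is \<open>4 * pi^2 / Gamma (1 / 4) ^ 4\<close>; eight times
  its square is the reciprocal of \<open>Phi\<close>.\<close>

lemma Phi_beta_moment: "8 * (beta_moment 1 / (2 * beta_moment 0))\<^sup>2 * Phi = 1"
proof -
  let ?G = "Gamma (1 / 4) :: real" and ?H = "Gamma (3 / 4) :: real"
  have pos: "?G > 0" "?H > 0" "Gamma (1 / 2 :: real) > 0"
    by (auto intro!: Gamma_real_pos)
  have "Gamma (1 / 4 + 1 :: real) = 1 / 4 * ?G"
    by (rule Gamma_plus1) (auto elim!: nonpos_Ints_cases)
  then have 54: "Gamma (5 / 4 :: real) = ?G / 4" by simp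
  have m: "beta_moment 0 = ?G * Gamma (1 / 2) / ?H" "beta_moment 1 = ?H * Gamma (1 / 2) / (?G / 4)"
    unfolding beta_moment_def Beta_def 54[symmetric] by simp_all
  have "h * c / (g / 4) / (2 * (g * c / h)) = 2 * h\<^sup>2 / g\<^sup>2" if "c > 0" for g h c :: real
    using that by (simp add: power2_eq_square)
  from this[OF pos(3)] have "beta_moment 1 / (2 * beta_moment 0) = 2 * ?H\<^sup>2 / ?G\<^sup>2"
    unfolding m .
  also have "?H = sqrt 2 * pi / ?G"
  proof -
    have "?G \<noteq> 0" by (rule less_imp_neq[OF pos(1), symmetric])
    then have "(?H = sqrt 2 * pi / ?G) = (?H * ?G = sqrt 2 * pi)"
      by (rule nonzero_eq_divide_eq)
    then show ?thesis
      using Gamma_quarter_product by (simp only: mult.commute)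
  qed
  also have "2 * (sqrt 2 * pi / ?G)\<^sup>2 / ?G\<^sup>2 = 4 * pi\<^sup>2 / ?G ^ 4"
    by (simp add: power_divide power_mult_distrib flip: power_add)
  finally have k: "beta_moment 1 / (2 * beta_moment 0) = 4 * pi\<^sup>2 / ?G ^ 4" .
  have "8 * (4 * p\<^sup>2 / g ^ 4)\<^sup>2 * (g ^ 8 / (128 * p ^ 4)) = 1" if "g \<noteq> 0" "p \<noteq> 0" for g p :: real
    using that by (simp add: power_divide power_mult_distrib flip: power_mult)
  from this[OF less_imp_neq[OF pos(1), symmetric] pi_neq_zero] show ?thesis
    unfolding k Phi_def .
qed

section \<open>The identity in the disc \<open>|t| < 1 / 4\<close> and its uniqueness\<close>

lemma genfun_sums_theta3_taylor:
  assumes t: "norm t < 1 / 4"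
  shows "(\<lambda>n. of_real (theta3_taylor n) / (2 ^ n * fact (2 * n)) * t ^ n * genfun_U t ^ (2 * n)) sums genfun_V t"
proof -
  \<comment> \<open>The result depends on \<open>w\<close> only through \<open>w^2 = 4 * t\<close>:
    the uniformizer is odd in \<open>w\<close> and enters through its square.\<close>
  define w where "w = csqrt (4 * t)"
  have w2: "w\<^sup>2 = 4 * t" by (simp add: w_def)
  have "(norm w)\<^sup>2 < 1\<^sup>2" using t by (simp add: norm_mult w2 flip: norm_power)
  then have w: "norm w < 1" by (rule power2_less_imp_less) simp
  let ?z = "uniformizer w"
  let ?k = "beta_moment 1 / (2 * beta_moment 0)"
  have U: "genfun_U t = hypO (w\<^sup>2) / hypE (w\<^sup>2)"
    by (simp add: genfun_U_def w2)
  \<comment> \<open>From \<open>w^2 = 4 * t\<close> and \<open>8 * ?k^2 * Phi = 1\<close>; the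
    remaining factor 1/2 is the source of \<open>2 ^ n\<close> in the generating function.\<close>
  have z: "of_real Phi * ?z\<^sup>2 = t * (genfun_U t)\<^sup>2 / 2"
  proof -
    have "of_real Phi * ?z\<^sup>2 = of_real Phi * (of_real ?k)\<^sup>2 * w\<^sup>2 * (genfun_U t)\<^sup>2"
      unfolding uniformizer_eq[OF w] U by (simp only: power_mult_distrib mult_ac)
    also have "\<dots> = of_real (8 * ?k\<^sup>2 * Phi) * (t * (genfun_U t)\<^sup>2 / 2)"
      unfolding w2 by simp
    also have "of_real (8 * ?k\<^sup>2 * Phi) = (1 :: complex)"
      unfolding Phi_beta_moment by simp
    finally show ?thesis by simp
  qed
  have t1: "theta3 1 \<noteq> 0"
    using theta_shift_pos[of 1 0] by (simp add: theta3_1)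
  have "(\<lambda>n. theta3 1 * (of_real (theta3_taylor n) / fact (2 * n) * of_real Phi ^ n * ?z ^ (2 * n)))
      sums (theta3 1 * genfun_V t)"
    using theta3_taylor_sums[OF uniformizer_norm_less[OF w]]
    unfolding sigma3_uniformizer[OF w] genfun_V_def w2 .
  from sums_divide[OF this, of "theta3 1"] t1
  have "(\<lambda>n. of_real (theta3_taylor n) / fact (2 * n) * of_real Phi ^ n * ?z ^ (2 * n)) sums genfun_V t"
    by simp
  also have "(\<lambda>n. of_real (theta3_taylor n) / fact (2 * n) * of_real Phi ^ n * ?z ^ (2 * n)) =
      (\<lambda>n. of_real (theta3_taylor n) / (2 ^ n * fact (2 * n)) * t ^ n * genfun_U t ^ (2 * n))"
  proof
    fix n
    have "of_real Phi ^ n * ?z ^ (2 * n) = (of_real Phi * ?z\<^sup>2) ^ n"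
      by (simp add: power_mult power_mult_distrib)
    also have "\<dots> = t ^ n * genfun_U t ^ (2 * n) / 2 ^ n"
      unfolding z by (simp add: power_mult power_mult_distrib power_divide)
    finally have "of_real Phi ^ n * ?z ^ (2 * n) = t ^ n * genfun_U t ^ (2 * n) / 2 ^ n" .
    then show "of_real (theta3_taylor n) / fact (2 * n) * of_real Phi ^ n * ?z ^ (2 * n) =
        of_real (theta3_taylor n) / (2 ^ n * fact (2 * n)) * t ^ n * genfun_U t ^ (2 * n)"
      by (simp only: mult.assoc) (simp add: mult_ac)
  qed
  finally show ?thesis .
qed

text \<open>\<open>U\<close> is continuous with value 1 at 0, so near 0 the product vanishes only at
  \<open>t = 0\<close>, and it tends to 0 there.\<close>

lemma islimpt_tUsq:
  "0 islimpt ((\<lambda>t. t * (genfun_U t)\<^sup>2) ` ball 0 (1 / 4))"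
proof -
  let ?s = "\<lambda>t. t * (genfun_U t)\<^sup>2"
  have E0: "hypE 0 \<noteq> 0" by (simp add: hyp2F1_at_0)
  have U0: "genfun_U 0 = 1" by (simp add: genfun_U_def hyp2F1_at_0)
  have cont: "isCont (\<lambda>t. f (4 * t)) 0" if "f holomorphic_on ball 0 1" for f :: "complex \<Rightarrow> complex"
  proof -
    have "isCont f (4 * 0)"
      using holomorphic_on_imp_continuous_on[OF that] by (simp add: continuous_on_eq_continuous_at)
    then show ?thesis by (intro isCont_o2[where g = f and f = "\<lambda>t. 4 * t"]) auto
  qed
  have U: "isCont genfun_U 0"
    unfolding genfun_U_def [abs_def]
    by (intro isCont_divide cont hypE_holomorphic hypO_holomorphic) (simp add: E0)
  then have "(genfun_U \<longlongrightarrow> 1) (at 0)" by (simp add: isCont_def U0)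
  then have nz: "\<forall>\<^sub>F t in at 0. genfun_U t \<noteq> 0"
    by (rule tendsto_imp_eventually_ne) simp
  have s: "(?s \<longlongrightarrow> 0) (at 0)"
    using \<open>(genfun_U \<longlongrightarrow> 1) (at 0)\<close> by (auto intro!: tendsto_eq_intros)
  show ?thesis
  proof (unfold islimpt_approachable, intro allI impI)
    fix e :: real assume "e > 0"
    with s have "\<forall>\<^sub>F t in at 0. dist (?s t) 0 < e" by (rule tendstoD)
    moreover have "\<forall>\<^sub>F t in at (0::complex). t \<in> ball 0 (1 / 4)"
      by (rule eventually_at_in_open') auto
    moreover have "\<forall>\<^sub>F t in at (0::complex). t \<noteq> 0" by (rule eventually_neq_at_within)
    ultimately have "\<forall>\<^sub>F t in at 0. t \<in> ball 0 (1 / 4) \<and> ?s t \<noteq> 0 \<and> dist (?s t) 0 < e"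
      using nz by eventually_elim simp
    then obtain t where "t \<in> ball 0 (1 / 4)" "?s t \<noteq> 0" "dist (?s t) 0 < e"
      using eventually_happens'[OF at_neq_bot] by blast
    then show "\<exists>x\<in>?s ` ball 0 (1 / 4). x \<noteq> 0 \<and> dist x 0 < e" by blast
  qed
qed

theorem theorem3:
  fixes e :: "nat \<Rightarrow> real"
  shows "(\<forall>t::complex. norm t < 1 / 4 \<longrightarrow>
            (\<lambda>n. of_real (e n) / (2 ^ n * fact (2 * n)) * t ^ n * genfun_U t ^ (2 * n))
              sums genfun_V t)
         \<longleftrightarrow> e = theta3_taylor"
proof
  assume e: "\<forall>t::complex. norm t < 1 / 4 \<longrightarrow>
            (\<lambda>n. of_real (e n) / (2 ^ n * fact (2 * n)) * t ^ n * genfun_U t ^ (2 * n))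
              sums genfun_V t"
  show "e = theta3_taylor"
  proof
    fix n
    let ?a = "\<lambda>n. of_real (e n - theta3_taylor n) / (2 ^ n * fact (2 * n)) :: complex"
    have "?a n = 0"
    \<comment> \<open>Subtracting the two expansions leaves a power series in
      \<open>s = t * U(t)^2\<close> that sums to 0 at all these values.\<close>
    proof (rule power_series_zero_if_islimpt[of _ ?a, OF islimpt_tUsq])
      fix s :: complex assume "s \<in> (\<lambda>t. t * (genfun_U t)\<^sup>2) ` ball 0 (1 / 4)"
      then obtain t where t: "s = t * (genfun_U t)\<^sup>2" "norm t < 1 / 4" by auto
      have "s ^ n = t ^ n * genfun_U t ^ (2 * n)" for n
        unfolding t(1) by (simp add: power_mult_distrib power_mult)
      moreover have "(\<lambda>n. of_real (e n) / (2 ^ n * fact (2 * n)) * t ^ n * genfun_U t ^ (2 * n) -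
          of_real (theta3_taylor n) / (2 ^ n * fact (2 * n)) * t ^ n * genfun_U t ^ (2 * n))
          sums (genfun_V t - genfun_V t)"
        using e t(2) genfun_sums_theta3_taylor[OF t(2)] by (intro sums_diff) auto
      ultimately show "(\<lambda>n. ?a n * s ^ n) sums 0"
        by (simp add: algebra_simps diff_divide_distrib)
    qed
    then show "e n = theta3_taylor n" by (simp flip: of_real_diff)
  qed
next
  assume "e = theta3_taylor"
  then show "\<forall>t::complex. norm t < 1 / 4 \<longrightarrow>
            (\<lambda>n. of_real (e n) / (2 ^ n * fact (2 * n)) * t ^ n * genfun_U t ^ (2 * n))
              sums genfun_V t"
    using genfun_sums_theta3_taylor by simp
qed

end
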